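(* Let $d=1$, $T=1$, and let $\alpha\in L^1(0,1)$. For $\mu\in(0,1)$ set $$\xi=e^{\frac12 W_1^2-\mu|W_1|+\frac12\mu^2}-1 ,$$ and consider the BSDE $$Y_t=\xi+\int_t^1(\alpha_s+|Z_s|)\,ds-\int_t^1 Z_s\,dW_s,\qquad t\in[0,1].\qquad( * )$$ (i) For every $\mu\in(0,1)$: $\xi\log^p(\xi+1)\in L^1(\Omega)$ for every $p\ge 1$, while $\mathbb{E}[\xi e^{|W_1|}]=+\infty$ and the BSDE $( * )$ does not admit a solution $(Y,Z)$ such that $Y\ge 0$. (ii) For every $\lambda>1$ and every $\mu\in\left(\frac{1}{\sqrt{\lambda}},1\right)$: $\mathbb{E}[\Psi_\lambda(\xi)]<+\infty$, where $\Psi_\lambda(x)=x\,e^{\left(\frac{2}{\lambda}\log(x+1)\right)^{1/2}}$ for $x\ge0$, while the BSDE $( * )$ does not admit a solution $(Y,Z)$ such that $Y\ge 0$.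
   Context: $(W_t)_{t\in[0,1]}$ is a standard real Brownian motion on a complete probability space $(\Omega,\mathcal{F},\mathbb{P})$; $(\mathcal{F}_t)$ is its natural filtration augmented by the $\mathbb{P}$-null sets of $\mathcal{F}$. The function $\alpha$ is deterministic. Note that $\xi=e^{\frac12(|W_1|-\mu)^2}-1\ge 0$. A solution to the BSDE $( * )$ is a pair $(Y_t,Z_t)_{t\in[0,1]}$ of real-valued predictable processes such that $\mathbb{P}$-a.s. $t\mapsto Y_t$ is continuous, $t\mapsto Z_t$ belongs to $L^2(0,1)$, $t\mapsto \alpha_t+|Z_t|$ belongs to $L^1(0,1)$, and $\mathbb{P}$-a.s. $(Y,Z)$ satisfies the equation for all $t\in[0,1]$. *)

theory Defs
  imports "HOL-Probability.Probability"
begin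

definition natural_filtration :: "'a measure \<Rightarrow> (real \<Rightarrow> 'a \<Rightarrow> real) \<Rightarrow> real \<Rightarrow> 'a measure" where
  "natural_filtration M W t =
     sigma (space M) {W s -` B \<inter> space M | s B. s \<in> {0..t} \<and> B \<in> sets borel}"

definition augmented_filtration :: "'a measure \<Rightarrow> (real \<Rightarrow> 'a \<Rightarrow> real) \<Rightarrow> real \<Rightarrow> 'a measure" where
  "augmented_filtration M W t =
     sigma (space M) (sets (natural_filtration M W t) \<union> null_sets M)"

locale brownian_motion = prob_space M
  for M :: "'a measure" and W :: "real \<Rightarrow> 'a \<Rightarrow> real" +
  assumes random_variable_W: "\<And>t. t \<in> {0..1} \<Longrightarrow> random_variable borel (W t)"
    and start: "AE \<omega> in M. W 0 \<omega> = 0"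
    and continuous_paths: "AE \<omega> in M. continuous_on {0..1} (\<lambda>t. W t \<omega>)"
    and normal_increments: "\<And>s t. \<lbrakk>0 \<le> s; s < t; t \<le> 1\<rbrakk> \<Longrightarrow>
      distributed M lborel (\<lambda>\<omega>. W t \<omega> - W s \<omega>) (normal_density 0 (sqrt (t - s)))"
    and independent_increments: "\<And>s t. \<lbrakk>0 \<le> s; s < t; t \<le> 1\<rbrakk> \<Longrightarrow>
      indep_set (sets (natural_filtration M W s))
        {(\<lambda>\<omega>. W t \<omega> - W s \<omega>) -` B \<inter> space M | B. B \<in> sets borel}"

definition predictable_algebra :: "'a measure \<Rightarrow> (real \<Rightarrow> 'a measure) \<Rightarrow> (real \<times> 'a) measure" where
  "predictable_algebra M F = sigma ({0..1} \<times> space M)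
     ({{0} \<times> A | A. A \<in> sets (F 0)} \<union>
      {{s<..t} \<times> A | s t A. 0 \<le> s \<and> s < t \<and> t \<le> 1 \<and> A \<in> sets (F s)})"

definition predictable :: "'a measure \<Rightarrow> (real \<Rightarrow> 'a measure) \<Rightarrow> (real \<Rightarrow> 'a \<Rightarrow> real) \<Rightarrow> bool" where
  "predictable M F X \<longleftrightarrow> (\<lambda>(t, \<omega>). X t \<omega>) \<in> borel_measurable (predictable_algebra M F)"

text \<open>A simple integrand is given by a partition
  \<open>0 = \<tau> 0 < \<dots> < \<tau> n = 1\<close> and bounded \<open>F (\<tau> i)\<close>-measurable weights \<open>h i\<close>.\<close>

definition simple_integrand ::
  "(real \<Rightarrow> 'a measure) \<Rightarrow> nat \<Rightarrow> (nat \<Rightarrow> real) \<Rightarrow> (nat \<Rightarrow> 'a \<Rightarrow> real) \<Rightarrow> bool" where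
  "simple_integrand F n \<tau> h \<longleftrightarrow>
     \<tau> 0 = 0 \<and> \<tau> n = 1 \<and> (\<forall>i<n. \<tau> i < \<tau> (Suc i)) \<and>
     (\<forall>i<n. h i \<in> borel_measurable (F (\<tau> i)) \<and> (\<exists>C. \<forall>\<omega>\<in>space (F (\<tau> i)). \<bar>h i \<omega>\<bar> \<le> C))"

definition simple_process ::
  "nat \<Rightarrow> (nat \<Rightarrow> real) \<Rightarrow> (nat \<Rightarrow> 'a \<Rightarrow> real) \<Rightarrow> real \<Rightarrow> 'a \<Rightarrow> real" where
  "simple_process n \<tau> h s \<omega> = (\<Sum>i<n. h i \<omega> * indicator {\<tau> i<..\<tau> (Suc i)} s)"

definition simple_integral ::
  "(real \<Rightarrow> 'a \<Rightarrow> real) \<Rightarrow> nat \<Rightarrow> (nat \<Rightarrow> real) \<Rightarrow> (nat \<Rightarrow> 'a \<Rightarrow> real) \<Rightarrow> real \<Rightarrow> 'a \<Rightarrow> real" where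
  "simple_integral W n \<tau> h t \<omega> =
     (\<Sum>i<n. h i \<omega> * (W (min (\<tau> (Suc i)) t) \<omega> - W (min (\<tau> i) t) \<omega>))"

definition null_in_probability :: "'a measure \<Rightarrow> (nat \<Rightarrow> 'a \<Rightarrow> ennreal) \<Rightarrow> bool" where
  "null_in_probability M X \<longleftrightarrow>
     (\<forall>n. X n \<in> borel_measurable M) \<and>
     (\<forall>\<epsilon>>0. (\<lambda>n. measure M {\<omega> \<in> space M. X n \<omega> > ennreal \<epsilon>}) \<longlonglongrightarrow> 0)"

text \<open>\<open>J\<close> is (a version of) the Ito integral process \<open>t \<mapsto> \<integral>\<^sub>0\<^sup>t Z\<^sub>s dW\<^sub>s\<close> on \<open>[0,1]\<close>, for predictable \<open>Z\<close>
  with almost surely square-integrable paths: the continuous adapted process which is the limit,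
  uniformly in time in probability, of the integrals of simple integrands approximating \<open>Z\<close> in
  \<open>L\<^sup>2(0,1)\<close> in probability. It is unique up to indistinguishability. The measurability demanded by
  \<open>null_in_probability\<close> is automatic when \<open>M\<close> is complete.\<close>

definition has_ito_integral ::
  "'a measure \<Rightarrow> (real \<Rightarrow> 'a measure) \<Rightarrow> (real \<Rightarrow> 'a \<Rightarrow> real) \<Rightarrow>
    (real \<Rightarrow> 'a \<Rightarrow> real) \<Rightarrow> (real \<Rightarrow> 'a \<Rightarrow> real) \<Rightarrow> bool" where
  "has_ito_integral M F W Z J \<longleftrightarrow>
     predictable M F Z \<and>
     (AE \<omega> in M. set_integrable lebesgue {0<..<1} (\<lambda>s. (Z s \<omega>)\<^sup>2)) \<and>
     (\<forall>t\<in>{0..1}. J t \<in> borel_measurable (F t)) \<and>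
     (AE \<omega> in M. continuous_on {0..1} (\<lambda>t. J t \<omega>)) \<and>
     (\<exists>n \<tau> h.
        (\<forall>k. simple_integrand F (n k) (\<tau> k) (h k)) \<and>
        null_in_probability M
          (\<lambda>k \<omega>. \<integral>\<^sup>+s\<in>{0<..<1}. ennreal ((simple_process (n k) (\<tau> k) (h k) s \<omega> - Z s \<omega>)\<^sup>2) \<partial>lebesgue) \<and>
        null_in_probability M
          (\<lambda>k \<omega>. SUP t\<in>{0..1}. ennreal \<bar>simple_integral W (n k) (\<tau> k) (h k) t \<omega> - J t \<omega>\<bar>))"

definition bsde_solution ::
  "'a measure \<Rightarrow> (real \<Rightarrow> 'a \<Rightarrow> real) \<Rightarrow> (real \<Rightarrow> real) \<Rightarrow> ('a \<Rightarrow> real) \<Rightarrow>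
    (real \<Rightarrow> 'a \<Rightarrow> real) \<Rightarrow> (real \<Rightarrow> 'a \<Rightarrow> real) \<Rightarrow> bool" where
  "bsde_solution M W \<alpha> \<xi> Y Z \<longleftrightarrow>
     predictable M (augmented_filtration M W) Y \<and>
     predictable M (augmented_filtration M W) Z \<and>
     (AE \<omega> in M. continuous_on {0..1} (\<lambda>t. Y t \<omega>)) \<and>
     (AE \<omega> in M. set_integrable lebesgue {0<..<1} (\<lambda>t. (Z t \<omega>)\<^sup>2)) \<and>
     (AE \<omega> in M. set_integrable lebesgue {0<..<1} (\<lambda>t. \<alpha> t + \<bar>Z t \<omega>\<bar>)) \<and>
     (\<exists>J. has_ito_integral M (augmented_filtration M W) W Z J \<and>
        (AE \<omega> in M. \<forall>t\<in>{0..1}.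
           Y t \<omega> = \<xi> \<omega> + (LINT s:{t..1}|lebesgue. \<alpha> s + \<bar>Z s \<omega>\<bar>) - (J 1 \<omega> - J t \<omega>)))"

definition nonneg_process :: "'a measure \<Rightarrow> (real \<Rightarrow> 'a \<Rightarrow> real) \<Rightarrow> bool" where
  "nonneg_process M Y \<longleftrightarrow> (AE \<omega> in M. \<forall>t\<in>{0..1}. 0 \<le> Y t \<omega>)"

definition terminal_value :: "(real \<Rightarrow> 'a \<Rightarrow> real) \<Rightarrow> real \<Rightarrow> 'a \<Rightarrow> real" where
  "terminal_value W \<mu> \<omega> = exp ((W 1 \<omega>)\<^sup>2 / 2 - \<mu> * \<bar>W 1 \<omega>\<bar> + \<mu>\<^sup>2 / 2) - 1"

definition Psi :: "real \<Rightarrow> real \<Rightarrow> real" where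
  "Psi \<Lambda> x = x * exp (sqrt (2 / \<Lambda> * ln (x + 1)))"

end

theory Submission
  imports Defs
begin

text \<open>
  Since \<open>Z \<le> \<bar>Z\<bar>\<close>, the process \<open>N = \<integral> Z dW - \<integral> Z ds\<close> dominates \<open>Y - Y\<^sub>0 + \<integral> \<alpha> ds\<close>, so it is bounded below
  if \<open>Y \<ge> 0\<close> and \<open>Y\<^sub>0\<close> is bounded. Under the measure with density \<open>exp (W\<^sub>1 - 1/2)\<close>, where \<open>W\<^sub>t - t\<close> is a
  Brownian motion, \<open>N\<close> is a local martingale bounded below, hence a supermartingale, and
  \<open>E[exp (W\<^sub>1 - 1/2) \<xi>]\<close> would be finite. But on \<open>{W\<^sub>1 > 0}\<close> the Gaussian density times
  \<open>exp (W\<^sub>1) (\<xi> + 1)\<close> grows like \<open>exp ((1 - \<mu>) x)\<close>.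

  No stochastic calculus is needed: the supermartingale property is proved for the approximating
  simple integrals, stopped on a fine grid when they fall below the lower bound. They converge to
  \<open>N\<close> uniformly in probability, so with high probability they are never stopped.
\<close>

subsection \<open>Independence and moments of the increments\<close>

text \<open>Three obstacles shape the argument. The Ito integral is known only as a limit in
  probability, which says nothing about expectations under an unbounded exponential weight. So the
  weighted terminal value is first truncated at a level \<open>R\<close>, and then an approximant is
  chosen whose bad event has probability \<open>P\<close> with \<open>R * P \<le> 1\<close>; the
  resulting bound is free of \<open>R\<close>, and monotone convergence removes the truncation.
  Next, the bound on the weights of the simple integrands may blow up along the approximating
  sequence, so the stopping grid is chosen afresh for each approximant, fine enough that overshoot
  costs at most 1 in mean. Finally, \<open>Y 0\<close> is random. Triviality of the initial
  sigma-algebra is bypassed: the estimate is made on an event \<open>Y 0 \<le> C\<close> of positive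
  probability, independent of \<open>W 1 - W 0\<close>, whose probability factors out. The
  approximation errors never need to be small: errors of at most 1 suffice, because only some finite
  bound is wanted.\<close>

lemma space_augmented_filtration [simp]: "space (augmented_filtration M W t) = space M"
  by (simp add: augmented_filtration_def space_measure_of_conv)

lemma sets_natural_filtration:
  "sets (natural_filtration M W t) =
    sigma_sets (space M) {W s -` B \<inter> space M | s B. s \<in> {0..t} \<and> B \<in> sets borel}"
  unfolding natural_filtration_def by (rule sets_measure_of) auto

lemma sets_augmented_filtration:
  "sets (augmented_filtration M W t) =
    sigma_sets (space M) (sets (natural_filtration M W t) \<union> null_sets M)"
proof -
  have "sets (natural_filtration M W t) \<subseteq> Pow (space M)"
    using sets.space_closed[of "natural_filtration M W t"]
    by (simp add: natural_filtration_def space_measure_of_conv)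
  then show ?thesis
    unfolding augmented_filtration_def
    by (intro sets_measure_of) (auto dest: null_setsD2 sets.sets_into_space)
qed

lemma sets_augmented_filtration_mono:
  assumes "s \<le> t"
  shows "sets (augmented_filtration M W s) \<subseteq> sets (augmented_filtration M W t)"
proof -
  have "sets (natural_filtration M W s) \<subseteq> sets (natural_filtration M W t)"
    unfolding sets_natural_filtration using assms by (intro sigma_sets_mono') fastforce
  then show ?thesis
    unfolding sets_augmented_filtration by (intro sigma_sets_mono') auto
qed

lemma measurable_augmented_filtration_mono:
  assumes "s \<le> t" "f \<in> borel_measurable (augmented_filtration M W s)"
  shows "f \<in> borel_measurable (augmented_filtration M W t)"
  by (rule measurable_mono[THEN subsetD, OF _ _ _ _ assms(2)])
    (use sets_augmented_filtration_mono[OF assms(1)] in auto)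

lemma measurable_augmented_filtration:
  assumes "0 \<le> s" "s \<le> t"
  shows "W s \<in> borel_measurable (augmented_filtration M W t)"
proof (rule measurableI)
  fix B :: "real set" assume "B \<in> sets borel"
  then have "W s -` B \<inter> space M \<in> sets (natural_filtration M W t)"
    unfolding sets_natural_filtration using assms by (intro sigma_sets.Basic) auto
  then show "W s -` B \<inter> space (augmented_filtration M W t) \<in> sets (augmented_filtration M W t)"
    unfolding sets_augmented_filtration by (auto intro: sigma_sets.Basic)
qed simp

lemma (in prob_space) indep_set_mono:
  assumes "indep_set A B" "A' \<subseteq> A" "B' \<subseteq> B"
  shows "indep_set A' B'"
  using assms unfolding indep_sets2_eq by (meson subset_iff)

section \<open>Independence of the increments from the augmented filtration\<close>

context brownian_motion
begin

abbreviation \<F> :: "real \<Rightarrow> 'a measure" where "\<F> \<equiv> augmented_filtration M W"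

lemma sets_natural_filtration_subset: "t \<le> 1 \<Longrightarrow> sets (natural_filtration M W t) \<subseteq> events"
  unfolding sets_natural_filtration
  by (rule sets.sigma_sets_subset) (auto intro!: measurable_sets[OF random_variable_W])

lemma sets_augmented_filtration_subset: "t \<le> 1 \<Longrightarrow> sets (\<F> t) \<subseteq> events"
  unfolding sets_augmented_filtration
  by (rule sets.sigma_sets_subset) (use sets_natural_filtration_subset in auto)

lemma measurable_events: "t \<le> 1 \<Longrightarrow> f \<in> borel_measurable (\<F> t) \<Longrightarrow> f \<in> borel_measurable M"
  by (rule measurable_mono[THEN subsetD, of borel borel "\<F> t" M])
    (use sets_augmented_filtration_subset in auto)

text \<open>The sets that agree almost everywhere with an event of the natural filtration form a
  sigma-algebra containing the null sets. This carries the independence assumed for the natural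
  filtration over to the augmented one.\<close>

lemma augmented_filtration_AE_eq:
  assumes "A \<in> sets (\<F> t)"
  shows "\<exists>A'\<in>sets (natural_filtration M W t). AE \<omega> in M. \<omega> \<in> A \<longleftrightarrow> \<omega> \<in> A'"
  using assms unfolding sets_augmented_filtration
proof (induction rule: sigma_sets.induct)
  case (Basic a)
  then show ?case
  proof
    assume "a \<in> null_sets M"
    then show ?thesis
      by (intro bexI[of _ "{}"]) (auto dest: AE_not_in)
  qed auto
next
  case Empty
  show ?case by (intro bexI[of _ "{}"]) auto
next
  case (Compl a)
  then obtain A' where A': "A' \<in> sets (natural_filtration M W t)" "AE \<omega> in M. \<omega> \<in> a \<longleftrightarrow> \<omega> \<in> A'"
    by auto
  have "space (natural_filtration M W t) - A' \<in> sets (natural_filtration M W t)"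
    using A' by auto
  then have "space M - A' \<in> sets (natural_filtration M W t)"
    by (simp add: natural_filtration_def space_measure_of_conv)
  then show ?case
    by (rule bexI[rotated]) (use A'(2) in auto)
next
  case (Union a)
  then have "\<forall>i. \<exists>A'. A' \<in> sets (natural_filtration M W t) \<and> (AE \<omega> in M. \<omega> \<in> a i \<longleftrightarrow> \<omega> \<in> A')"
    by auto
  then obtain A' where A': "\<And>i. A' i \<in> sets (natural_filtration M W t)"
    "\<And>i. AE \<omega> in M. \<omega> \<in> a i \<longleftrightarrow> \<omega> \<in> A' i"
    by metis
  have "AE \<omega> in M. \<forall>i. \<omega> \<in> a i \<longleftrightarrow> \<omega> \<in> A' i"
    using A'(2) by (simp add: AE_all_countable)
  then have "AE \<omega> in M. \<omega> \<in> (\<Union>i. a i) \<longleftrightarrow> \<omega> \<in> (\<Union>i. A' i)"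
    by eventually_elim auto
  then show ?case
    using A'(1) by (intro bexI[of _ "\<Union>i. A' i"]) auto
qed

lemma indep_var_increment:
  assumes st: "0 \<le> s" "s < t" "t \<le> 1"
    and U: "U \<in> borel_measurable (\<F> s)" and f: "f \<in> borel_measurable borel"
  shows "indep_var borel U borel (\<lambda>\<omega>. f (W t \<omega> - W s \<omega>) :: real)"
proof -
  let ?D = "\<lambda>\<omega>. W t \<omega> - W s \<omega>"
  have [measurable]: "W t \<in> borel_measurable M" "W s \<in> borel_measurable M"
    using st by (auto intro!: random_variable_W)
  have "indep_set (sets (\<F> s)) {?D -` B \<inter> space M | B. B \<in> sets borel}"
  proof (rule indep_setI)
    show "sets (\<F> s) \<subseteq> events"
      using st by (intro sets_augmented_filtration_subset) auto
    show "{?D -` B \<inter> space M | B. B \<in> sets borel} \<subseteq> events"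
      by auto
    fix A D assume A: "A \<in> sets (\<F> s)" and D: "D \<in> {?D -` B \<inter> space M | B. B \<in> sets borel}"
    obtain A' where A': "A' \<in> sets (natural_filtration M W s)" "AE \<omega> in M. \<omega> \<in> A \<longleftrightarrow> \<omega> \<in> A'"
      using augmented_filtration_AE_eq[OF A] by auto
    have ev: "A \<in> events" "A' \<in> events" "D \<in> events"
      using A A' D sets_augmented_filtration_subset[of s] sets_natural_filtration_subset[of s] st
      by auto
    have "prob (A \<inter> D) = prob (A' \<inter> D)"
      using A'(2) ev by (intro measure_eq_AE) auto
    also have "\<dots> = prob A' * prob D"
      using indep_setD[OF independent_increments[OF st] A'(1) D] .
    also have "prob A' = prob A"
      using A'(2) ev by (intro measure_eq_AE) auto
    finally show "prob (A \<inter> D) = prob A * prob D" .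
  qed
  moreover have "{U -` B \<inter> space M |B. B \<in> sets borel} \<subseteq> sets (\<F> s)"
    using measurable_sets[OF U] by auto
  moreover have "{(\<lambda>\<omega>. f (?D \<omega>)) -` B \<inter> space M |B. B \<in> sets borel}
      \<subseteq> {?D -` B \<inter> space M | B. B \<in> sets borel}"
  proof safe
    fix B :: "real set" assume B: "B \<in> sets borel"
    have "f -` B \<in> sets borel"
      using measurable_sets[OF f B] by simp
    then show "\<exists>C. (\<lambda>\<omega>. f (?D \<omega>)) -` B \<inter> space M = ?D -` C \<inter> space M \<and> C \<in> sets borel"
      by (intro exI[of _ "f -` B"]) auto
  qed
  ultimately have "indep_set {U -` B \<inter> space M |B. B \<in> sets borel}
      {(\<lambda>\<omega>. f (?D \<omega>)) -` B \<inter> space M |B. B \<in> sets borel}"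
    by (rule indep_set_mono)
  \<comment> \<open>\<open>indep_var\<close> speaks of generated sigma-algebras; the preimage
    families are closed under intersection, which is what the extension of independence
    requires.\<close>
  then have "indep_set (sigma_sets (space M) {U -` B \<inter> space M |B. B \<in> sets borel})
      (sigma_sets (space M) {(\<lambda>\<omega>. f (?D \<omega>)) -` B \<inter> space M |B. B \<in> sets borel})"
  proof (rule indep_set_sigma_sets)
    show "Int_stable {U -` B \<inter> space M |B. B \<in> sets borel}"
    proof (rule Int_stableI, elim CollectE exE conjE, simp only:, intro CollectI)
      fix A B :: "real set" assume "A \<in> sets borel" "B \<in> sets borel"
      then show "\<exists>C. U -` A \<inter> space M \<inter> (U -` B \<inter> space M) = U -` C \<inter> space M \<and> C \<in> sets borel"
        by (intro exI[of _ "A \<inter> B"]) auto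
    qed
    let ?V = "\<lambda>\<omega>. f (?D \<omega>)"
    show "Int_stable {?V -` B \<inter> space M |B. B \<in> sets borel}"
    proof (rule Int_stableI, elim CollectE exE conjE, simp only:, intro CollectI)
      fix A B :: "real set" assume "A \<in> sets borel" "B \<in> sets borel"
      then show "\<exists>C. ?V -` A \<inter> space M \<inter> (?V -` B \<inter> space M) = ?V -` C \<inter> space M \<and> C \<in> sets borel"
        by (intro exI[of _ "A \<inter> B"]) auto
    qed
  qed
  moreover have "random_variable borel U"
    using measurable_events[OF _ U] st by simp
  moreover have "random_variable borel (\<lambda>\<omega>. f (?D \<omega>))"
    using f by measurable
  ultimately show ?thesis
    unfolding indep_var_eq by simp
qed

lemma
  assumes st: "0 \<le> s" "s < t" "t \<le> 1"
    and U: "U \<in> borel_measurable (\<F> s)" "integrable M U"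
    and f: "f \<in> borel_measurable borel" "integrable M (\<lambda>\<omega>. f (W t \<omega> - W s \<omega>) :: real)"
  shows integrable_increment_mult: "integrable M (\<lambda>\<omega>. U \<omega> * f (W t \<omega> - W s \<omega>))" (is ?I)
    and expectation_increment_mult:
      "expectation (\<lambda>\<omega>. U \<omega> * f (W t \<omega> - W s \<omega>)) =
        expectation U * expectation (\<lambda>\<omega>. f (W t \<omega> - W s \<omega>))" (is ?E)
proof -
  note ind = indep_var_increment[OF st U(1) f(1)]
  show ?I by (rule indep_var_integrable[OF ind U(2) f(2)])
  show ?E by (rule indep_var_lebesgue_integral[OF ind U(2) f(2)])
qed

text \<open>Girsanov for a single Gaussian increment: multiplying the centred density of variance
  \<open>t - s\<close> by \<open>exp (x - (t - s) / 2)\<close> moves its mean to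
  \<open>t - s\<close>. Weighted expectations thus become ordinary normal moments.\<close>

lemma has_bochner_integral_exp_increment:
  assumes st: "0 \<le> s" "s < t" "t \<le> 1" and g: "g \<in> borel_measurable borel"
    and I: "has_bochner_integral lborel (\<lambda>x. normal_density (t - s) (sqrt (t - s)) x * g x) I"
  shows "integrable M (\<lambda>\<omega>. exp ((W t \<omega> - W s \<omega>) - (t - s) / 2) * g (W t \<omega> - W s \<omega>))"
    and "expectation (\<lambda>\<omega>. exp ((W t \<omega> - W s \<omega>) - (t - s) / 2) * g (W t \<omega> - W s \<omega>)) = I"
proof -
  let ?d = "normal_density 0 (sqrt (t - s))"
  let ?f = "\<lambda>x. exp (x - (t - s) / 2) * g x"
  have "normal_density (t - s) (sqrt (t - s)) x = ?d x * exp (x - (t - s) / 2)" for x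
    using st by (simp add: normal_density_def exp_add[symmetric] field_simps power2_eq_square)
  then have eq: "(\<lambda>x. normal_density (t - s) (sqrt (t - s)) x * g x) = (\<lambda>x. ?d x * ?f x)"
    by (auto simp: mult.assoc)
  note D = normal_increments[OF st]
  have f: "?f \<in> borel_measurable lborel"
    using g by measurable
  show "integrable M (\<lambda>\<omega>. ?f (W t \<omega> - W s \<omega>))"
    using distributed_integrable[OF D f] I unfolding eq by (auto simp: has_bochner_integral_iff)
  show "expectation (\<lambda>\<omega>. ?f (W t \<omega> - W s \<omega>)) = I"
    using distributed_integral[OF D f] I unfolding eq by (auto simp: has_bochner_integral_iff)
qed

text \<open>Each moment has its own task: the zeroth keeps the weights at mean 1, the first makes
  the drift-corrected increments martingale differences under the weights, and the fourth pays for
  the overshoot.\<close>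

lemma exp_increment_moments:
  assumes st: "0 \<le> s" "s < t" "t \<le> 1"
  defines "\<Delta> \<equiv> \<lambda>\<omega>. W t \<omega> - W s \<omega>" and "d \<equiv> t - s"
  shows "integrable M (\<lambda>\<omega>. exp (\<Delta> \<omega> - d / 2))"
    and "integrable M (\<lambda>\<omega>. exp (\<Delta> \<omega> - d / 2) * (\<Delta> \<omega> - d))"
    and "integrable M (\<lambda>\<omega>. exp (\<Delta> \<omega> - d / 2) * (\<Delta> \<omega> - d) ^ 4)"
    and "expectation (\<lambda>\<omega>. exp (\<Delta> \<omega> - d / 2)) = 1"
    and "expectation (\<lambda>\<omega>. exp (\<Delta> \<omega> - d / 2) * (\<Delta> \<omega> - d)) = 0"
    and "expectation (\<lambda>\<omega>. exp (\<Delta> \<omega> - d / 2) * (\<Delta> \<omega> - d) ^ 4) = 3 * d\<^sup>2"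
proof -
  have d: "0 < sqrt (t - s)" using st by simp
  have 4: "has_bochner_integral lborel
      (\<lambda>x. normal_density (t - s) (sqrt (t - s)) x * (x - (t - s)) ^ 4) (3 * d\<^sup>2)"
    using normal_moment_even[OF d, of "t - s" 2] st
    by (simp add: d_def fact_numeral power_divide)
  note m = has_bochner_integral_exp_increment[OF st, of "\<lambda>_. 1" 1]
    has_bochner_integral_exp_increment[OF st, of "\<lambda>x. x - (t - s)" 0]
    has_bochner_integral_exp_increment[OF st _ 4]
  show "integrable M (\<lambda>\<omega>. exp (\<Delta> \<omega> - d / 2))" "expectation (\<lambda>\<omega>. exp (\<Delta> \<omega> - d / 2)) = 1"
    using m(1,2) normal_moment_even[OF d, of "t - s" 0] by (auto simp: \<Delta>_def d_def)
  show "integrable M (\<lambda>\<omega>. exp (\<Delta> \<omega> - d / 2) * (\<Delta> \<omega> - d))"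
    "expectation (\<lambda>\<omega>. exp (\<Delta> \<omega> - d / 2) * (\<Delta> \<omega> - d)) = 0"
    using m(3,4) normal_moment_odd[OF d, of "t - s" 0] by (auto simp: \<Delta>_def d_def)
  show "integrable M (\<lambda>\<omega>. exp (\<Delta> \<omega> - d / 2) * (\<Delta> \<omega> - d) ^ 4)"
    "expectation (\<lambda>\<omega>. exp (\<Delta> \<omega> - d / 2) * (\<Delta> \<omega> - d) ^ 4) = 3 * d\<^sup>2"
    using m(5,6) by (auto simp: \<Delta>_def d_def)
qed

end

subsection \<open>The stopped discrete integral\<close>

lemma partition_mono:
  fixes \<tau> :: "nat \<Rightarrow> real"
  assumes "\<And>i. i < n \<Longrightarrow> \<tau> i < \<tau> (Suc i)" "i \<le> j" "j \<le> n"
  shows "\<tau> i \<le> \<tau> j"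
  using assms(2,3)
  by (induction rule: dec_induct) (use assms(1) in \<open>auto simp: Suc_le_eq intro: order_trans[OF _ less_imp_le]\<close>)

lemma integrable_weighted_max:
  fixes E X :: "'a \<Rightarrow> real"
  assumes E: "integrable M E" "\<And>\<omega>. 0 \<le> E \<omega>" and EX: "integrable M (\<lambda>\<omega>. E \<omega> * X \<omega>)"
    and [measurable]: "X \<in> borel_measurable M" "B \<in> sets M" and b: "0 \<le> b"
  shows "integrable M (\<lambda>\<omega>. E \<omega> * max (X \<omega>) (- b) * indicator B \<omega>)"
proof (rule Bochner_Integration.integrable_bound)
  have [measurable]: "E \<in> borel_measurable M"
    using E(1) by (rule borel_measurable_integrable)
  show "(\<lambda>\<omega>. E \<omega> * max (X \<omega>) (- b) * indicator B \<omega>) \<in> borel_measurable M"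
    by measurable
  show "integrable M (\<lambda>\<omega>. \<bar>E \<omega> * X \<omega>\<bar> + b * E \<omega>)"
    using E EX by auto
  have "E \<omega> * \<bar>max (X \<omega>) (- b)\<bar> \<le> E \<omega> * \<bar>X \<omega>\<bar> + b * E \<omega>" for \<omega>
  proof -
    have "E \<omega> * \<bar>max (X \<omega>) (- b)\<bar> \<le> E \<omega> * (\<bar>X \<omega>\<bar> + b)"
      using E b by (intro mult_left_mono) auto
    then show ?thesis by (simp add: algebra_simps)
  qed
  then show "AE \<omega> in M. norm (E \<omega> * max (X \<omega>) (- b) * indicator B \<omega>) \<le>
      norm (\<bar>E \<omega> * X \<omega>\<bar> + b * E \<omega>)"
    using E b by (intro AE_I2) (auto simp: abs_mult indicator_def)
qed

text \<open>The partial sums of \<open>D\<close>, frozen once they are at or below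
  \<open>- a\<close>: a discrete first-passage stopping. Whether step \<open>D l\<close> is taken is
  decided by the earlier steps alone, so the stopped coefficients stay adapted.\<close>

primrec absorbed_sum :: "real \<Rightarrow> (nat \<Rightarrow> real) \<Rightarrow> nat \<Rightarrow> real" where
  "absorbed_sum a D 0 = 0"
| "absorbed_sum a D (Suc l) =
    absorbed_sum a D l + (if absorbed_sum a D l > - a then D l else 0)"

lemma absorbed_sum_eq_sum:
  assumes "\<And>j. j < l \<Longrightarrow> (\<Sum>i<j. D i) > - a"
  shows "absorbed_sum a D l = (\<Sum>i<l. D i)"
  using assms by (induction l) auto

text \<open>Truncation at \<open>- a - 1\<close> is convex and may raise the mean, but only when a
  step starting above \<open>- a\<close> exceeds 1 in size; the gain is then below
  \<open>|D l| - 1\<close>, hence below the fourth power. A square would not do: the second moments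
  add up to order \<open>C ^ 2\<close> whatever the mesh, whereas the fourth moments add up to the
  order of the mesh.\<close>

lemma absorbed_sum_overshoot:
  "max (absorbed_sum a D (Suc l)) (- a - 1) \<le> max (absorbed_sum a D l) (- a - 1) +
    (if absorbed_sum a D l > - a then D l else 0) + (D l) ^ 4"
proof -
  have "\<bar>D l\<bar> \<le> 1 + D l ^ 4"
  proof (cases "\<bar>D l\<bar> \<le> 1")
    case False
    then have "\<bar>D l\<bar> ^ 1 \<le> \<bar>D l\<bar> ^ 4"
      by (intro power_increasing) auto
    then show ?thesis by simp
  qed (auto intro: add_increasing2)
  moreover have "0 \<le> D l ^ 4" by simp
  ultimately show ?thesis
    by (auto simp: max_def)
qed

context brownian_motion
begin

text \<open>Discrete optional stopping under the weights \<open>E\<close>, i.e. under the measure with drift \<open>1\<close>. A step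
  overshoots the level \<open>-a\<close> by more than \<open>1\<close> only if it exceeds \<open>1\<close> itself, and then by at most
  its fourth power; hence the total error is of the order of the mesh.\<close>

lemma discrete_supermartingale_bound:
  fixes g :: "nat \<Rightarrow> real"
  assumes g: "g 0 = 0" "\<And>j. j < N \<Longrightarrow> g j < g (Suc j)" "g N = 1"
    and H: "\<And>j. j < N \<Longrightarrow> H j \<in> borel_measurable (\<F> (g j))"
      "\<And>j \<omega>. j < N \<Longrightarrow> \<omega> \<in> space M \<Longrightarrow> \<bar>H j \<omega>\<bar> \<le> C"
    and B: "B \<in> sets (\<F> 0)"
    and a: "0 \<le> a"
  defines "D \<equiv> \<lambda>\<omega> j. H j \<omega> * (W (g (Suc j)) \<omega> - W (g j) \<omega> - (g (Suc j) - g j))"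
  defines "X \<equiv> \<lambda>l \<omega>. absorbed_sum a (D \<omega>) l"
  defines "E \<equiv> \<lambda>l \<omega>. exp (W (g l) \<omega> - g l / 2)"
  assumes "l \<le> N"
  shows "X l \<in> borel_measurable (\<F> (g l)) \<and> integrable M (E l) \<and> expectation (E l) = 1 \<and>
    integrable M (\<lambda>\<omega>. E l \<omega> * X l \<omega>) \<and>
    expectation (\<lambda>\<omega>. E l \<omega> * max (X l \<omega>) (- a - 1) * indicator B \<omega>)
      \<le> (\<Sum>j<l. 3 * C ^ 4 * (g (Suc j) - g j)\<^sup>2)"
  using \<open>l \<le> N\<close>
proof (induction l)
  case 0
  have [measurable]: "W 0 \<in> borel_measurable M"
    by (rule random_variable_W) simp
  \<comment> \<open>\<open>W 0\<close> vanishes only almost surely, so the initial weight is 1 only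
    up to a null set.\<close>
  have "AE \<omega> in M. E 0 \<omega> = 1"
    using start by eventually_elim (simp add: E_def g)
  moreover have "E 0 \<in> borel_measurable M"
    unfolding E_def g by simp
  ultimately have "integrable M (E 0)" "expectation (E 0) = 1"
    using integrable_cong_AE[of "E 0" M "\<lambda>_. 1"] integral_cong_AE[of "E 0" M "\<lambda>_. 1"] prob_space
    by auto
  then show ?case
    using a by (simp add: X_def max_def)
next
  case (Suc l)
  then have l: "l < N" by simp
  note mono = partition_mono[of N g, OF g(2)]
  have st: "0 \<le> g l" "g l < g (Suc l)" "g (Suc l) \<le> 1"
    using mono[of 0 l] mono[of "Suc l" N] g l by auto
  have IH: "X l \<in> borel_measurable (\<F> (g l))" "integrable M (E l)" "expectation (E l) = 1"
    "integrable M (\<lambda>\<omega>. E l \<omega> * X l \<omega>)"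
    "expectation (\<lambda>\<omega>. E l \<omega> * max (X l \<omega>) (- a - 1) * indicator B \<omega>)
      \<le> (\<Sum>j<l. 3 * C ^ 4 * (g (Suc j) - g j)\<^sup>2)"
    using Suc by auto
  define \<Delta> where "\<Delta> = (\<lambda>\<omega>. W (g (Suc l)) \<omega> - W (g l) \<omega>)"
  define d where "d = g (Suc l) - g l"
  define e where "e = (\<lambda>x. exp (x - d / 2))"
  \<comment> \<open>The coefficient actually in force on this step. It is known at time
    \<open>g l\<close>, so the increment can be factored out by independence.\<close>
  define K where "K = (\<lambda>\<omega>. if X l \<omega> > - a then H l \<omega> else 0)"
  define e1 where "e1 = (\<lambda>x. e x * (x - d))"
  define e4 where "e4 = (\<lambda>x. e x * (x - d) ^ 4)"
  have e_meas: "e \<in> borel_measurable borel" "e1 \<in> borel_measurable borel" "e4 \<in> borel_measurable borel"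
    unfolding e_def e1_def e4_def by measurable
  have mom: "integrable M (\<lambda>\<omega>. e (\<Delta> \<omega>))" "integrable M (\<lambda>\<omega>. e1 (\<Delta> \<omega>))" "integrable M (\<lambda>\<omega>. e4 (\<Delta> \<omega>))"
    "expectation (\<lambda>\<omega>. e (\<Delta> \<omega>)) = 1" "expectation (\<lambda>\<omega>. e1 (\<Delta> \<omega>)) = 0"
    "expectation (\<lambda>\<omega>. e4 (\<Delta> \<omega>)) = 3 * d\<^sup>2"
    using exp_increment_moments[OF st] by (simp_all add: e_def e1_def e4_def \<Delta>_def d_def)
  have E_Suc: "E (Suc l) \<omega> = E l \<omega> * e (\<Delta> \<omega>)" for \<omega>
    by (simp add: E_def e_def \<Delta>_def d_def exp_add[symmetric] field_simps)
  have X_Suc: "X (Suc l) \<omega> = X l \<omega> + K \<omega> * (\<Delta> \<omega> - d)" for \<omega>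
    by (simp add: X_def K_def D_def \<Delta>_def d_def)
  have C: "\<bar>K \<omega>\<bar> \<le> C" if "\<omega> \<in> space M" for \<omega>
    using H(2)[OF l that] by (auto simp: K_def)

  note [measurable] = IH(1) H(1)[OF l] measurable_augmented_filtration[OF st(1) order_refl, of W M]
  have E_meas [measurable]: "E l \<in> borel_measurable (\<F> (g l))"
    unfolding E_def by measurable
  have K_meas [measurable]: "K \<in> borel_measurable (\<F> (g l))"
    unfolding K_def by measurable
  have B_meas [measurable]: "B \<in> sets (\<F> (g l))"
    using B sets_augmented_filtration_mono[OF st(1)] by blast
  note to_M = measurable_events[of "g l"]
  have l1: "g l \<le> 1" using st by simp
  have prod: "integrable M (\<lambda>\<omega>. U \<omega> * f (\<Delta> \<omega>))"
    "expectation (\<lambda>\<omega>. U \<omega> * f (\<Delta> \<omega>)) = expectation U * expectation (\<lambda>\<omega>. f (\<Delta> \<omega>))"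
    if "U \<in> borel_measurable (\<F> (g l))" "integrable M U" "f \<in> borel_measurable borel"
      "integrable M (\<lambda>\<omega>. f (\<Delta> \<omega>))" for U :: "'a \<Rightarrow> real" and f :: "real \<Rightarrow> real"
    using integrable_increment_mult[OF st, of U f] expectation_increment_mult[OF st, of U f] that
    unfolding \<Delta>_def by auto

  have EK: "integrable M (\<lambda>\<omega>. E l \<omega> * K \<omega> * indicator S \<omega>)" if [measurable]: "S \<in> sets (\<F> (g l))" for S
  proof (rule Bochner_Integration.integrable_bound)
    show "integrable M (\<lambda>\<omega>. C * E l \<omega>)" using IH(2) by simp
    have "E l \<omega> * \<bar>K \<omega>\<bar> \<le> \<bar>C\<bar> * E l \<omega>" if "\<omega> \<in> space M" for \<omega>
      using mult_left_mono[OF C[OF that], of "E l \<omega>"] abs_ge_self[of C]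
      by (smt (verit) E_def exp_ge_zero mult.commute mult_right_mono)
    then show "AE \<omega> in M. norm (E l \<omega> * K \<omega> * indicator S \<omega>) \<le> norm (C * E l \<omega>)"
      by (intro AE_I2) (auto simp: abs_mult E_def indicator_def)
  qed (intro to_M[OF l1], measurable)
  have B_ev: "B \<in> events"
    using B sets_augmented_filtration_subset[of 0] by auto
  have EX: "integrable M (\<lambda>\<omega>. E k \<omega> * max (X k \<omega>) (- a - 1) * indicator B \<omega>)"
    if "integrable M (E k)" "integrable M (\<lambda>\<omega>. E k \<omega> * X k \<omega>)" "X k \<in> borel_measurable M" for k
    using integrable_weighted_max[OF that(1) _ that(2,3) B_ev, of "a + 1"] a by (simp add: E_def)

  have X_Suc_meas: "X (Suc l) \<in> borel_measurable (\<F> (g (Suc l)))"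
  proof -
    have [measurable]: "W (g (Suc l)) \<in> borel_measurable (\<F> (g (Suc l)))" "W (g l) \<in> borel_measurable (\<F> (g (Suc l)))"
      using st by (auto intro!: measurable_augmented_filtration)
    have [measurable]: "X l \<in> borel_measurable (\<F> (g (Suc l)))" "K \<in> borel_measurable (\<F> (g (Suc l)))"
      using st IH(1) K_meas by (auto intro: measurable_augmented_filtration_mono[of "g l"])
    show ?thesis
      unfolding X_Suc \<Delta>_def by measurable
  qed
  moreover have E_Suc_int: "integrable M (E (Suc l))" "expectation (E (Suc l)) = 1"
    unfolding E_Suc using prod[OF E_meas IH(2) e_meas(1) mom(1)] mom IH(3) by auto
  moreover have EX_Suc_int: "integrable M (\<lambda>\<omega>. E (Suc l) \<omega> * X (Suc l) \<omega>)"
  proof -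
    have "integrable M (\<lambda>\<omega>. E l \<omega> * X l \<omega> * e (\<Delta> \<omega>) + E l \<omega> * K \<omega> * indicator (space M) \<omega> * e1 (\<Delta> \<omega>))"
      using EK[of "space M"] sets.top[of "\<F> (g l)"]
      by (intro Bochner_Integration.integrable_add prod(1) IH(4) e_meas mom(1,2)) (auto, measurable)
    then show ?thesis
      by (rule Bochner_Integration.integrable_cong[THEN iffD1, rotated -1])
        (auto simp: E_Suc X_Suc e1_def algebra_simps)
  qed
  moreover have "expectation (\<lambda>\<omega>. E (Suc l) \<omega> * max (X (Suc l) \<omega>) (- a - 1) * indicator B \<omega>)
      \<le> (\<Sum>j<Suc l. 3 * C ^ 4 * (g (Suc j) - g j)\<^sup>2)"
  proof -
    \<comment> \<open>\<open>R1\<close> reproduces the previous expectation, \<open>R2\<close> is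
      the martingale increment of mean zero, and \<open>R3\<close> is the overshoot.
      \<open>R3\<close> carries no indicator of \<open>B\<close>: being nonnegative, it can only
      enlarge the bound.\<close>
    define R1 where "R1 = (\<lambda>\<omega>. (E l \<omega> * max (X l \<omega>) (- a - 1) * indicator B \<omega>) * e (\<Delta> \<omega>))"
    define R2 where "R2 = (\<lambda>\<omega>. (E l \<omega> * K \<omega> * indicator B \<omega>) * e1 (\<Delta> \<omega>))"
    define R3 where "R3 = (\<lambda>\<omega>. (C ^ 4 * E l \<omega>) * e4 (\<Delta> \<omega>))"
    have m: "(\<lambda>\<omega>. E l \<omega> * max (X l \<omega>) (- a - 1) * indicator B \<omega>) \<in> borel_measurable (\<F> (g l))"
      "(\<lambda>\<omega>. E l \<omega> * K \<omega> * indicator B \<omega>) \<in> borel_measurable (\<F> (g l))"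
      "(\<lambda>\<omega>. C ^ 4 * E l \<omega>) \<in> borel_measurable (\<F> (g l))"
      by measurable
    have C4: "integrable M (\<lambda>\<omega>. C ^ 4 * E l \<omega>)" using IH(2) by simp
    have R: "integrable M R1" "integrable M R2" "integrable M R3"
      "expectation R1 = expectation (\<lambda>\<omega>. E l \<omega> * max (X l \<omega>) (- a - 1) * indicator B \<omega>)"
      "expectation R2 = 0" "expectation R3 = 3 * C ^ 4 * d\<^sup>2"
      unfolding R1_def R2_def R3_def
      using prod[OF m(1) EX[OF IH(2,4) to_M[OF l1 IH(1)]] e_meas(1) mom(1)] prod[OF m(2) EK[OF B_meas] e_meas(2) mom(2)]
        prod[OF m(3) C4 e_meas(3) mom(3)] mom IH(3)
      by simp_all
    have "E (Suc l) \<omega> * max (X (Suc l) \<omega>) (- a - 1) * indicator B \<omega> \<le> R1 \<omega> + R2 \<omega> + R3 \<omega>"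
      if \<omega>: "\<omega> \<in> space M" for \<omega>
    proof -
      have "H l \<omega> ^ 4 \<le> C ^ 4"
        using power_mono[OF H(2)[OF l \<omega>], of 4] by simp
      then have "D \<omega> l ^ 4 \<le> C ^ 4 * (\<Delta> \<omega> - d) ^ 4"
        by (auto simp: D_def \<Delta>_def d_def power_mult_distrib intro: mult_right_mono)
      then have "max (X (Suc l) \<omega>) (- a - 1) \<le> max (X l \<omega>) (- a - 1) + K \<omega> * (\<Delta> \<omega> - d) + C ^ 4 * (\<Delta> \<omega> - d) ^ 4"
        using absorbed_sum_overshoot[of a "D \<omega>" l]
        by (auto simp: X_def K_def D_def \<Delta>_def d_def split: if_splits)
      then have *: "E (Suc l) \<omega> * max (X (Suc l) \<omega>) (- a - 1) \<le>
          E (Suc l) \<omega> * (max (X l \<omega>) (- a - 1) + K \<omega> * (\<Delta> \<omega> - d) + C ^ 4 * (\<Delta> \<omega> - d) ^ 4)"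
        by (intro mult_left_mono) (auto simp: E_def)
      have "0 \<le> R3 \<omega>"
        by (simp add: R3_def E_def e4_def e_def)
      with * show ?thesis
        by (auto simp: R1_def R2_def R3_def E_Suc e1_def e4_def indicator_def algebra_simps)
    qed
    then have "expectation (\<lambda>\<omega>. E (Suc l) \<omega> * max (X (Suc l) \<omega>) (- a - 1) * indicator B \<omega>)
        \<le> expectation (\<lambda>\<omega>. R1 \<omega> + R2 \<omega> + R3 \<omega>)"
      if "integrable M (\<lambda>\<omega>. E (Suc l) \<omega> * max (X (Suc l) \<omega>) (- a - 1) * indicator B \<omega>)"
      using that R by (intro integral_mono) auto
    moreover have "integrable M (\<lambda>\<omega>. E (Suc l) \<omega> * max (X (Suc l) \<omega>) (- a - 1) * indicator B \<omega>)"
      by (rule EX[OF E_Suc_int(1) EX_Suc_int measurable_events[OF st(3) X_Suc_meas]])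
    ultimately show ?thesis
      using R IH(5) by (simp add: d_def)
  qed
  ultimately show ?case by simp
qed

end

subsection \<open>Simple integrals along a path\<close>

text \<open>Index \<open>j\<close> is the piece \<open>j mod m\<close> of the partition interval
  \<open>j div m\<close>, so the weight in force on that step is \<open>h (j div m)\<close>. At
  \<open>j = n * m\<close> the formula mentions \<open>\<tau> (Suc n)\<close>, which lies beyond the
  partition, but with the factor 0.\<close>

definition refined_grid :: "nat \<Rightarrow> (nat \<Rightarrow> real) \<Rightarrow> nat \<Rightarrow> real" where
  "refined_grid m \<tau> j =
    \<tau> (j div m) + real (j mod m) / real m * (\<tau> (Suc (j div m)) - \<tau> (j div m))"

lemma refined_grid_step:
  assumes "0 < m"
  shows "refined_grid m \<tau> (Suc j) - refined_grid m \<tau> j = (\<tau> (Suc (j div m)) - \<tau> (j div m)) / real m"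
proof (cases "Suc (j mod m) = m")
  \<comment> \<open>The last piece of an interval: the next index belongs to the following interval,
    at offset 0.\<close>
  case True
  then have "real (j mod m) = real m - 1" by linarith
  then have "real (j mod m) / real m = 1 - 1 / real m" using assms by (simp add: field_simps)
  moreover have "Suc j div m = Suc (j div m)" "Suc j mod m = 0"
    using True by (auto simp: div_Suc mod_Suc)
  ultimately show ?thesis
    by (simp only: refined_grid_def) (simp add: diff_divide_distrib left_diff_distrib)
next
  case False
  then have "Suc j div m = j div m" "Suc j mod m = Suc (j mod m)"
    using assms by (auto simp: div_Suc mod_Suc)
  then show ?thesis
    using assms by (simp add: refined_grid_def field_simps)
qed

lemma refined_grid_bounds:
  assumes "0 < m" "\<tau> (j div m) < \<tau> (Suc (j div m))"
  shows "\<tau> (j div m) \<le> refined_grid m \<tau> j" "refined_grid m \<tau> j < refined_grid m \<tau> (Suc j)"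
    "refined_grid m \<tau> (Suc j) \<le> \<tau> (Suc (j div m))"
proof -
  let ?d = "\<tau> (Suc (j div m)) - \<tau> (j div m)"
  show "\<tau> (j div m) \<le> refined_grid m \<tau> j"
    using assms by (simp add: refined_grid_def)
  have "0 < ?d / real m" using assms by simp
  then show "refined_grid m \<tau> j < refined_grid m \<tau> (Suc j)"
    using refined_grid_step[OF assms(1), of \<tau> j] by linarith
  have "Suc (j mod m) \<le> m" using mod_less_divisor[OF assms(1), of j] by linarith
  then have "real (j mod m) + 1 \<le> real m" by linarith
  then have "(real (j mod m) + 1) / real m * ?d \<le> 1 * ?d"
    using assms by (intro mult_right_mono) (auto simp: divide_simps)
  moreover have "refined_grid m \<tau> (Suc j) = \<tau> (j div m) + (real (j mod m) + 1) / real m * ?d"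
    using refined_grid_step[OF assms(1), of \<tau> j]
    by (simp add: refined_grid_def[of m \<tau> j] add_divide_distrib diff_divide_distrib algebra_simps)
  ultimately show "refined_grid m \<tau> (Suc j) \<le> \<tau> (Suc (j div m))"
    by simp
qed

text \<open>Between two times of one partition interval only its own summand moves: earlier summands
  are complete and later ones have not started. The integrator \<open>V\<close> is arbitrary so that
  it can be the drift-corrected motion \<open>W t - t\<close>.\<close>

lemma simple_integral_increment:
  fixes \<tau> :: "nat \<Rightarrow> real"
  assumes \<tau>: "\<And>i. i < n \<Longrightarrow> \<tau> i < \<tau> (Suc i)" and i: "i < n"
    and st: "\<tau> i \<le> s" "s \<le> t" "t \<le> \<tau> (Suc i)"
  shows "simple_integral V n \<tau> h t \<omega> - simple_integral V n \<tau> h s \<omega> = h i \<omega> * (V t \<omega> - V s \<omega>)"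
proof -
  note mono = partition_mono[of n \<tau>, OF \<tau>]
  have "simple_integral V n \<tau> h t \<omega> - simple_integral V n \<tau> h s \<omega> =
      (\<Sum>k<n. if k = i then h i \<omega> * (V t \<omega> - V s \<omega>) else 0)"
    unfolding simple_integral_def sum_subtractf[symmetric]
  proof (rule sum.cong)
    fix k assume "k \<in> {..<n}"
    then have k: "k < n" by simp
    consider "k < i" | "k = i" | "k > i" by linarith
    then show "h k \<omega> * (V (min (\<tau> (Suc k)) t) \<omega> - V (min (\<tau> k) t) \<omega>) -
        h k \<omega> * (V (min (\<tau> (Suc k)) s) \<omega> - V (min (\<tau> k) s) \<omega>) =
        (if k = i then h i \<omega> * (V t \<omega> - V s \<omega>) else 0)"
    proof cases
      case 1
      then have "\<tau> (Suc k) \<le> s" "\<tau> k \<le> s"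
        using mono[of "Suc k" i] mono[of k i] i st by auto
      then show ?thesis using 1 st by (simp add: min_def)
    next
      case 2
      then show ?thesis using st by (auto simp: min_def algebra_simps)
    next
      case 3
      then have "t \<le> \<tau> k" "t \<le> \<tau> (Suc k)"
        using mono[of "Suc i" k] mono[of "Suc i" "Suc k"] k st by auto
      then have "min (\<tau> k) t = t" "min (\<tau> (Suc k)) t = t" "min (\<tau> k) s = s" "min (\<tau> (Suc k)) s = s"
        using st by (auto simp: min_def)
      then show ?thesis using 3 by simp
    qed
  qed simp
  also have "\<dots> = h i \<omega> * (V t \<omega> - V s \<omega>)"
    using i by simp
  finally show ?thesis .
qed

lemma simple_integral_0:
  fixes \<tau> :: "nat \<Rightarrow> real"
  assumes \<tau>: "\<tau> 0 = 0" "\<And>i. i < n \<Longrightarrow> \<tau> i < \<tau> (Suc i)"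
  shows "simple_integral V n \<tau> h 0 \<omega> = 0"
proof -
  have "min (\<tau> i) 0 = 0" if "i \<le> n" for i
    using partition_mono[of n \<tau> 0 i] \<tau> that by auto
  then show ?thesis
    by (simp add: simple_integral_def)
qed

lemma simple_integral_refined_grid:
  fixes \<tau> :: "nat \<Rightarrow> real"
  assumes \<tau>: "\<tau> 0 = 0" "\<And>i. i < n \<Longrightarrow> \<tau> i < \<tau> (Suc i)" and m: "0 < m" and l: "l \<le> n * m"
  defines "g \<equiv> refined_grid m \<tau>"
  shows "simple_integral V n \<tau> h (g l) \<omega> = (\<Sum>j<l. h (j div m) \<omega> * (V (g (Suc j)) \<omega> - V (g j) \<omega>))"
  using l
proof (induction l)
  case 0
  then show ?case
    using simple_integral_0[of \<tau> n, OF \<tau>] \<tau>(1) by (simp add: g_def refined_grid_def)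
next
  case (Suc l)
  then have i: "l div m < n"
    using m by (simp add: div_less_iff_less_mult)
  show ?case
    using simple_integral_increment[of n \<tau>, OF \<tau>(2) i, where s = "g l" and t = "g (Suc l)" and V = V and h = h and \<omega> = \<omega>]
      refined_grid_bounds[OF m \<tau>(2)[OF i]] Suc by (simp add: g_def algebra_simps)
qed

section \<open>Lebesgue integrals of simple processes and the pathwise lower bound\<close>

lemma measure_Ico_Int_Ioc:
  fixes x y t :: real
  assumes "0 \<le> x" "x < y" "0 \<le> t"
  shows "measure lebesgue ({0..<t} \<inter> {x<..y}) = min y t - min x t"
    "{0..<t} \<inter> {x<..y} \<in> fmeasurable lebesgue"
proof -
  have "{0..<t} \<inter> {x<..y} = (if t \<le> x then {} else if y < t then {x<..y} else {x<..<t})"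
    using assms by auto
  then show "measure lebesgue ({0..<t} \<inter> {x<..y}) = min y t - min x t"
    "{0..<t} \<inter> {x<..y} \<in> fmeasurable lebesgue"
    using assms by (auto simp: min_def intro!: fmeasurableI)
qed

text \<open>With time itself as integrator, \<open>simple_integral\<close> is the ordinary integral
  in \<open>ds\<close>. The half-open \<open>{0..<t}\<close> is the complement in
  \<open>{0..1}\<close> of the interval \<open>{t..1}\<close> over which the equation
  integrates.\<close>

lemma has_bochner_integral_simple_process:
  fixes \<tau> :: "nat \<Rightarrow> real"
  assumes \<tau>: "\<tau> 0 = 0" "\<And>i. i < n \<Longrightarrow> \<tau> i < \<tau> (Suc i)" and "0 \<le> t"
  shows "has_bochner_integral lebesgue (\<lambda>s. indicator {0..<t} s *\<^sub>R simple_process n \<tau> h s \<omega>)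
    (simple_integral (\<lambda>t \<omega>. t) n \<tau> h t \<omega>)"
proof -
  have "has_bochner_integral lebesgue
      (\<lambda>s. \<Sum>i<n. indicator ({0..<t} \<inter> {\<tau> i<..\<tau> (Suc i)}) s *\<^sub>R h i \<omega>)
      (\<Sum>i<n. measure lebesgue ({0..<t} \<inter> {\<tau> i<..\<tau> (Suc i)}) *\<^sub>R h i \<omega>)"
  proof (intro has_bochner_integral_sum has_bochner_integral_indicator)
    fix i assume "i \<in> {..<n}"
    then have "0 \<le> \<tau> i" "\<tau> i < \<tau> (Suc i)"
      using partition_mono[of n \<tau> 0 i] \<tau> by auto
    then have "{0..<t} \<inter> {\<tau> i<..\<tau> (Suc i)} \<in> fmeasurable lebesgue"
      using measure_Ico_Int_Ioc(2) assms(3) by blast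
    then show "{0..<t} \<inter> {\<tau> i<..\<tau> (Suc i)} \<in> sets lebesgue"
      "emeasure lebesgue ({0..<t} \<inter> {\<tau> i<..\<tau> (Suc i)}) < \<infinity>"
      by (auto simp: fmeasurable_def)
  qed
  moreover have "(\<Sum>i<n. measure lebesgue ({0..<t} \<inter> {\<tau> i<..\<tau> (Suc i)}) *\<^sub>R h i \<omega>) =
      simple_integral (\<lambda>t \<omega>. t) n \<tau> h t \<omega>"
    unfolding simple_integral_def
  proof (rule sum.cong)
    fix i assume "i \<in> {..<n}"
    then have "0 \<le> \<tau> i" "\<tau> i < \<tau> (Suc i)"
      using partition_mono[of n \<tau> 0 i] \<tau> by auto
    then show "measure lebesgue ({0..<t} \<inter> {\<tau> i<..\<tau> (Suc i)}) *\<^sub>R h i \<omega> =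
        h i \<omega> * (min (\<tau> (Suc i)) t - min (\<tau> i) t)"
      using measure_Ico_Int_Ioc(1)[of "\<tau> i" "\<tau> (Suc i)" t] assms(3) by simp
  qed simp
  moreover have "(\<lambda>s. \<Sum>i<n. indicator ({0..<t} \<inter> {\<tau> i<..\<tau> (Suc i)}) s *\<^sub>R h i \<omega>) =
      (\<lambda>s. indicator {0..<t} s *\<^sub>R simple_process n \<tau> h s \<omega>)"
    unfolding simple_process_def real_scaleR_def sum_distrib_left
    by (intro ext sum.cong) (auto simp: indicator_def)
  ultimately show ?thesis by simp
qed

lemma set_integrable_closed_unit_interval:
  fixes f :: "real \<Rightarrow> real"
  assumes "set_integrable lebesgue {0<..<1} f"
  shows "set_integrable lebesgue {0..1} f"
  using assms unfolding set_integrable_def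
  by (rule integrable_discrete_difference[where X = "{0, 1}", THEN iffD1, rotated -1])
    (auto simp: indicator_def)

text \<open>By the equation, \<open>j t - j 0\<close> is \<open>y t - y 0\<close> plus the integral
  of \<open>\<alpha> + |z|\<close> up to \<open>t\<close>, and the integral of \<open>|z|\<close>
  nearly absorbs the drift term. The loss of 4 is made up of 2 for comparing the simple process with
  \<open>|z|\<close>, 1 for the error at \<open>j t\<close>, and 1 for \<open>j 0\<close>, which is
  not assumed to vanish.\<close>

lemma simple_integral_lower_bound:
  fixes \<tau> :: "nat \<Rightarrow> real" and \<alpha> z y j :: "real \<Rightarrow> real"
  assumes \<tau>: "\<tau> 0 = 0" "\<And>i. i < n \<Longrightarrow> \<tau> i < \<tau> (Suc i)"
    and \<alpha>: "set_integrable lebesgue {0<..<1} \<alpha>"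
    and z: "set_integrable lebesgue {0<..<1} (\<lambda>s. \<alpha> s + \<bar>z s\<bar>)"
    and close: "(\<integral>\<^sup>+s\<in>{0<..<1}. ennreal ((simple_process n \<tau> h s \<omega> - z s)\<^sup>2) \<partial>lebesgue) \<le> 1"
    and j: "\<And>t. t \<in> {0..1} \<Longrightarrow> \<bar>simple_integral W n \<tau> h t \<omega> - j t\<bar> \<le> 1"
    and y: "\<And>t. t \<in> {0..1} \<Longrightarrow> y t = \<xi> + (LINT s:{t..1}|lebesgue. \<alpha> s + \<bar>z s\<bar>) - (j 1 - j t)"
    and t: "t \<in> {0..1}"
  shows "simple_integral (\<lambda>t \<omega>. W t \<omega> - t) n \<tau> h t \<omega>
    \<ge> y t - y 0 - (LINT s:{0..1}|lebesgue. \<bar>\<alpha> s\<bar>) - 4"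
proof -
  let ?L = "\<lambda>f. LINT s:{0..<t}|lebesgue. f s"
  define p where "p = (\<lambda>s. simple_process n \<tau> h s \<omega>)"
  have \<alpha>1: "set_integrable lebesgue {0..1} \<alpha>"
    using \<alpha> by (rule set_integrable_closed_unit_interval)
  have f1: "set_integrable lebesgue {0..1} (\<lambda>s. \<alpha> s + \<bar>z s\<bar>)"
    using z by (rule set_integrable_closed_unit_interval)
  have "set_integrable lebesgue {0..1} (\<lambda>s. (\<alpha> s + \<bar>z s\<bar>) - \<alpha> s)"
    using f1 \<alpha>1 by (rule set_integral_diff(1))
  then have z1: "set_integrable lebesgue {0..1} (\<lambda>s. \<bar>z s\<bar>)"
    by simp
  have sub: "set_integrable lebesgue {0..<t} f" "set_integrable lebesgue {t..1} f"
    if "set_integrable lebesgue {0..1} f" for f :: "real \<Rightarrow> real"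
    using t by (auto intro!: set_integrable_subset[OF that])
  have p: "set_integrable lebesgue {0..<t} p" "?L p = simple_integral (\<lambda>t \<omega>. t) n \<tau> h t \<omega>"
    using has_bochner_integral_simple_process[of \<tau> n t h \<omega>, OF \<tau>] t
    by (auto simp: p_def set_integrable_def set_lebesgue_integral_def has_bochner_integral_iff)
  \<comment> \<open>Absolute values are taken inside the square because the hypotheses yield
    measurability of \<open>|z|\<close>, as the difference of \<open>\<alpha> + |z|\<close> and
    \<open>\<alpha>\<close>, but not of \<open>z\<close>. The reverse triangle inequality still
    bounds \<open>q\<close> by the square of \<open>p - z\<close>.\<close>
  define q where "q = (\<lambda>s. (\<bar>p s\<bar> - \<bar>z s\<bar>)\<^sup>2)"
  have q_int: "set_integrable lebesgue {0..<t} q" and q_le: "?L q \<le> 1"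
  proof -
    have [measurable]: "(\<lambda>s. indicator {0..<t} s * \<bar>z s\<bar>) \<in> borel_measurable lebesgue"
      "(\<lambda>s. indicator {0..<t} s * p s) \<in> borel_measurable lebesgue"
      using sub[OF z1] p(1) by (auto simp: set_integrable_def dest: borel_measurable_integrable)
    have eq: "indicator {0..<t} s *\<^sub>R q s = (\<bar>indicator {0..<t} s * p s\<bar> - indicator {0..<t} s * \<bar>z s\<bar>)\<^sup>2" for s
      by (auto simp: q_def indicator_def)
    have meas: "(\<lambda>s. indicator {0..<t} s *\<^sub>R q s) \<in> borel_measurable lebesgue"
      unfolding eq by measurable
    have "(\<integral>\<^sup>+s. ennreal (indicator {0..<t} s *\<^sub>R q s) \<partial>lebesgue)
        \<le> (\<integral>\<^sup>+s\<in>{0<..<1}. ennreal ((p s - z s)\<^sup>2) \<partial>lebesgue)"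
    proof (rule nn_integral_mono_AE)
      have "AE s in lebesgue. s \<noteq> (0::real)"
        by (rule AE_I[of _ _ "{0}"]) auto
      then show "AE s in lebesgue. ennreal (indicator {0..<t} s *\<^sub>R q s)
          \<le> ennreal ((p s - z s)\<^sup>2) * indicator {0<..<1} s"
      proof eventually_elim
        fix s :: real assume "s \<noteq> 0"
        have "q s \<le> (p s - z s)\<^sup>2"
          unfolding q_def by (rule abs_le_square_iff[THEN iffD1]) linarith
        then show "ennreal (indicator {0..<t} s *\<^sub>R q s) \<le> ennreal ((p s - z s)\<^sup>2) * indicator {0<..<1} s"
          using \<open>s \<noteq> 0\<close> t by (auto simp: indicator_def ennreal_leI)
      qed
    qed
    also have "\<dots> \<le> 1" using close by (simp add: p_def)
    finally have le: "(\<integral>\<^sup>+s. ennreal (indicator {0..<t} s *\<^sub>R q s) \<partial>lebesgue) \<le> 1" .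
    have nonneg: "0 \<le> indicator {0..<t} s *\<^sub>R q s" for s
      by (simp add: q_def)
    show int: "set_integrable lebesgue {0..<t} q"
      unfolding set_integrable_def
      by (rule integrableI_nonneg[OF meas]) (use nonneg le in \<open>auto intro: le_less_trans\<close>)
    show "?L q \<le> 1"
      using nn_integral_eq_integral[OF int[unfolded set_integrable_def]] nonneg le
      by (auto simp: set_lebesgue_integral_def)
  qed
  have one: "set_integrable lebesgue {0..<t} (\<lambda>s. 1 :: real)" "?L (\<lambda>s. 1 :: real) = t"
    using t by (auto simp: set_integrable_def set_lebesgue_integral_def)
  \<comment> \<open>The inequality \<open>x \<le> 1 + x ^ 2\<close> at
    \<open>x = |p s| - |z s|\<close> turns the square distance into a bound for the integrals, at a
    total cost of \<open>t + 1\<close>, hence at most 2.\<close>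
  have "?L p \<le> ?L (\<lambda>s. \<bar>z s\<bar> + (1 + q s))"
  proof (rule set_integral_mono)
    fix s
    have "\<bar>p s\<bar> - \<bar>z s\<bar> \<le> 1 + (\<bar>p s\<bar> - \<bar>z s\<bar>)\<^sup>2"
      using zero_le_power2[of "\<bar>p s\<bar> - \<bar>z s\<bar> - 1"] zero_le_power2[of "\<bar>p s\<bar> - \<bar>z s\<bar>"]
      by (auto simp: power2_eq_square algebra_simps)
    then show "p s \<le> \<bar>z s\<bar> + (1 + q s)"
      unfolding q_def by linarith
  qed (intro p set_integral_add sub z1 one q_int)+
  also have "\<dots> = ?L (\<lambda>s. \<bar>z s\<bar>) + (t + ?L q)"
    using sub[OF z1] one q_int by (simp add: set_integral_add)
  finally have p_le: "?L p \<le> ?L (\<lambda>s. \<bar>z s\<bar>) + 2"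
    using q_le t by simp
  have "?L (\<lambda>s. - \<alpha> s) \<le> (LINT s:{0..1}|lebesgue. \<bar>\<alpha> s\<bar>)"
  proof -
    have abs: "set_integrable lebesgue {0..1} (\<lambda>s. \<bar>\<alpha> s\<bar>)"
      using \<alpha>1 by (rule set_integrable_abs)
    then have "?L (\<lambda>s. \<bar>\<alpha> s\<bar>) \<le> (LINT s:{0..1}|lebesgue. \<bar>\<alpha> s\<bar>)"
      using t sub(1)[OF abs] unfolding set_lebesgue_integral_def set_integrable_def
      by (intro integral_mono) (auto simp: indicator_def)
    moreover have "?L (\<lambda>s. - \<alpha> s) \<le> ?L (\<lambda>s. \<bar>\<alpha> s\<bar>)"
      using sub(1)[OF \<alpha>1]
      by (intro set_integral_mono set_integrable_abs) (auto simp: set_integrable_def)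
    ultimately show ?thesis by linarith
  qed
  then have \<alpha>_ge: "- (LINT s:{0..1}|lebesgue. \<bar>\<alpha> s\<bar>) \<le> ?L \<alpha>"
    by (simp add: set_lebesgue_integral_def)
  have f_split: "(LINT s:{0..1}|lebesgue. \<alpha> s + \<bar>z s\<bar>) =
      ?L \<alpha> + ?L (\<lambda>s. \<bar>z s\<bar>) + (LINT s:{t..1}|lebesgue. \<alpha> s + \<bar>z s\<bar>)"
  proof -
    have "{0..1} = {0..<t} \<union> {t..1}" "{0..<t} \<inter> {t..1} = {}" using t by auto
    then show ?thesis
      using set_integral_Un[OF _ sub[OF f1]] set_integral_add[OF sub(1)[OF \<alpha>1] sub(1)[OF z1]]
      by auto
  qed
  have "simple_integral (\<lambda>t \<omega>. W t \<omega> - t) n \<tau> h t \<omega> =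
      simple_integral W n \<tau> h t \<omega> - simple_integral (\<lambda>t \<omega>. t) n \<tau> h t \<omega>"
    by (simp add: simple_integral_def sum_subtractf[symmetric] algebra_simps)
  moreover have "\<bar>j 0\<bar> \<le> 1"
    using j[of 0] simple_integral_0[of \<tau> n W h \<omega>] \<tau> by simp
  ultimately show ?thesis
    using j[OF t] y[OF t] y[of 0] f_split p_le p(2) \<alpha>_ge by auto
qed

subsection \<open>Integrals of functions of the terminal value\<close>

lemma integrable_exp_neg_abs:
  fixes c :: real
  assumes "0 < c"
  shows "integrable lborel (\<lambda>x. exp (- c * \<bar>x\<bar>))"
proof -
  have "integrable lborel (erlang_density 0 c)"
    using nn_integral_erlang_ith_moment[OF assms, of 0 0] assms by (intro integrableI_nonneg) auto
  then have "integrable lborel (\<lambda>x. erlang_density 0 c x / c)"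
    by simp
  moreover have "(\<lambda>x. erlang_density 0 c x / c) = (\<lambda>x. indicator {0..} x *\<^sub>R exp (- c * \<bar>x\<bar>))"
    using assms by (auto simp: erlang_density_def indicator_def fun_eq_iff)
  ultimately have "integrable lborel (\<lambda>x. indicator {0..} x *\<^sub>R exp (- c * \<bar>x\<bar>))"
    by simp
  then have "has_bochner_integral lborel (\<lambda>x. indicator {0..} x *\<^sub>R exp (- c * \<bar>x\<bar>))
      (LINT x|lborel. indicator {0..} x *\<^sub>R exp (- c * \<bar>x\<bar>))"
    by (simp add: has_bochner_integral_iff)
  then show ?thesis
    by (rule integrable.intros[OF has_bochner_integral_even_function]) simp
qed

lemma terminal_value_eq: "terminal_value W \<mu> \<omega> = exp ((\<bar>W 1 \<omega>\<bar> - \<mu>)\<^sup>2 / 2) - 1"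
  by (simp add: terminal_value_def power2_diff diff_divide_distrib add_divide_distrib algebra_simps)

lemma exp_square_shift_le:
  fixes \<mu> x :: real
  assumes "0 \<le> \<mu>" "\<mu> \<le> 1"
  shows "exp ((\<bar>x\<bar> - \<mu>)\<^sup>2 / 2) \<le> exp (1 / 2) * exp (x\<^sup>2 / 2 - \<mu> * \<bar>x\<bar>)"
proof -
  have "\<mu>\<^sup>2 \<le> 1" using assms by (simp add: power_le_one)
  then show ?thesis
    by (simp add: exp_add[symmetric] power2_diff field_simps)
qed

text \<open>This is \<open>1 + u \<le> exp u\<close> at \<open>u = c / p * x\<close>, raised to the
  power \<open>p\<close>; the maximum keeps the constant usable when \<open>p / c\<close> is below
  1.\<close>

lemma powr_le_exp:
  fixes p c x :: real
  assumes "0 < p" "0 < c" "0 \<le> x"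
  shows "(1 + x) powr p \<le> max 1 (p / c) powr p * exp (c * x)"
proof -
  let ?K = "max 1 (p / c)"
  have "1 + x \<le> ?K * (1 + c / p * x)"
  proof -
    have "x = (p / c) * (c / p * x)" using assms by simp
    also have "\<dots> \<le> ?K * (c / p * x)" using assms by (intro mult_right_mono) auto
    finally have "x \<le> ?K * (c / p * x)" .
    then show ?thesis by (simp add: distrib_left add_mono)
  qed
  also have "\<dots> \<le> ?K * exp (c / p * x)"
    by (intro mult_left_mono exp_ge_add_one_self) auto
  finally have "(1 + x) powr p \<le> (?K * exp (c / p * x)) powr p"
    using assms by (intro powr_mono2) auto
  also have "\<dots> = ?K powr p * exp (c * x)"
    using assms by (simp add: powr_mult exp_powr_real)
  finally show ?thesis .
qed

section \<open>Finite and infinite expectations of functions of \<open>W 1\<close>\<close>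

context brownian_motion
begin

lemma measurable_W1 [measurable]: "W 1 \<in> borel_measurable M"
  by (rule random_variable_W) simp

lemma AE_increment_W1: "AE \<omega> in M. W 1 \<omega> - W 0 \<omega> = W 1 \<omega>"
  using start by eventually_elim simp

lemma distributed_W1: "distributed M lborel (W 1) std_normal_density"
proof -
  have [measurable]: "W 0 \<in> borel_measurable M"
    by (rule random_variable_W) simp
  have D: "distributed M lborel (\<lambda>\<omega>. W 1 \<omega> - W 0 \<omega>) std_normal_density"
    using normal_increments[of 0 1] by simp
  have "distr M lborel (\<lambda>\<omega>. W 1 \<omega> - W 0 \<omega>) = distr M lborel (W 1)"
    using AE_increment_W1 by (intro distr_cong_AE) auto
  then show ?thesis
    using D by (auto simp: distributed_def)
qed

text \<open>The normal density cancels exactly the factor \<open>exp (x ^ 2 / 2)\<close>, so any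
  positive rate \<open>c\<close> that is left makes the integral converge. Each finite moment below
  comes down to checking that such a rate remains.\<close>

lemma integrable_terminal:
  assumes g: "g \<in> borel_measurable borel" and c: "0 < c"
    and bound: "\<And>x. \<bar>g x\<bar> \<le> K * exp (x\<^sup>2 / 2 - c * \<bar>x\<bar>)"
  shows "integrable M (\<lambda>\<omega>. g (W 1 \<omega>) :: real)"
proof -
  have "integrable lborel (\<lambda>x. std_normal_density x * g x)"
  proof (rule Bochner_Integration.integrable_bound)
    show "integrable lborel (\<lambda>x. (K / sqrt (2 * pi)) * exp (- c * \<bar>x\<bar>))"
      using integrable_exp_neg_abs[OF c] by simp
    show "(\<lambda>x. std_normal_density x * g x) \<in> borel_measurable lborel"
      using g by measurable
    have "std_normal_density x * \<bar>g x\<bar> \<le> (K / sqrt (2 * pi)) * exp (- c * \<bar>x\<bar>)" for x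
    proof -
      have "std_normal_density x * \<bar>g x\<bar> \<le> std_normal_density x * (K * exp (x\<^sup>2 / 2 - c * \<bar>x\<bar>))"
        by (intro mult_left_mono bound) simp
      also have "\<dots> = (K / sqrt (2 * pi)) * (exp (- x\<^sup>2 / 2) * exp (x\<^sup>2 / 2 - c * \<bar>x\<bar>))"
        by (simp add: std_normal_density_def)
      also have "exp (- x\<^sup>2 / 2) * exp (x\<^sup>2 / 2 - c * \<bar>x\<bar>) = exp (- c * \<bar>x\<bar>)"
        by (simp add: exp_add[symmetric])
      finally show ?thesis .
    qed
    then have "std_normal_density x * \<bar>g x\<bar> \<le> \<bar>(K / sqrt (2 * pi)) * exp (- c * \<bar>x\<bar>)\<bar>" for x
      by (rule order_trans) (rule abs_ge_self)
    then show "AE x in lborel. norm (std_normal_density x * g x) \<le> norm ((K / sqrt (2 * pi)) * exp (- c * \<bar>x\<bar>))"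
      by (intro AE_I2) (simp only: real_norm_def abs_mult[of "std_normal_density _"] abs_of_nonneg[OF normal_density_nonneg])
  qed
  then show ?thesis
    using distributed_integrable[OF distributed_W1, of g] g by simp
qed

text \<open>Against the normal density such a \<open>g\<close> stays above a positive constant on a
  half-line, which has infinite Lebesgue measure.\<close>

lemma nn_integral_terminal_eq_top:
  assumes g: "g \<in> borel_measurable borel"
    and bound: "\<And>x. 0 \<le> x \<Longrightarrow> c * exp (x\<^sup>2 / 2) \<le> g x" and c: "0 < c"
  shows "(\<integral>\<^sup>+\<omega>. ennreal (g (W 1 \<omega>)) \<partial>M) = \<infinity>"
proof -
  have Ici: "emeasure lborel {0::real..} = \<infinity>"
  proof (rule ccontr)
    assume "emeasure lborel {0::real..} \<noteq> \<infinity>"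
    then obtain r where r: "0 \<le> r" "emeasure lborel {0::real..} = ennreal r"
      by (cases "emeasure lborel {0::real..}") auto
    have "emeasure lborel {0..r + 1} \<le> emeasure lborel {0::real..}"
      by (rule emeasure_mono) auto
    then show False
      using r by simp
  qed
  have "(\<infinity> :: ennreal) = ennreal (c / sqrt (2 * pi)) * emeasure lborel {0::real..}"
    using c by (simp add: ennreal_mult_top Ici)
  also have "\<dots> = (\<integral>\<^sup>+x. ennreal (c / sqrt (2 * pi)) * indicator {0::real..} x \<partial>lborel)"
    by (rule nn_integral_cmult_indicator[symmetric]) simp
  also have "\<dots> \<le> (\<integral>\<^sup>+x. ennreal (std_normal_density x) * ennreal (g x) \<partial>lborel)"
  proof (rule nn_integral_mono)
    fix x :: real
    show "ennreal (c / sqrt (2 * pi)) * indicator {0..} x \<le> ennreal (std_normal_density x) * ennreal (g x)"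
    proof (cases "0 \<le> x")
      case True
      have "c / sqrt (2 * pi) = std_normal_density x * (c * exp (x\<^sup>2 / 2))"
        by (simp add: std_normal_density_def exp_minus field_simps)
      also have "\<dots> \<le> std_normal_density x * g x"
        by (intro mult_left_mono bound True) simp
      finally show ?thesis
        using True by (simp add: ennreal_mult'[symmetric] ennreal_leI)
    qed simp
  qed
  also have "\<dots> = (\<integral>\<^sup>+\<omega>. ennreal (g (W 1 \<omega>)) \<partial>M)"
    using g by (intro distributed_nn_integral[OF distributed_W1]) measurable
  finally show ?thesis by (simp add: top_unique)
qed

text \<open>The logarithm is \<open>q\<close>, quadratic in \<open>W 1\<close>, so its power is at
  most of degree \<open>2 * p\<close>. The rate \<open>\<mu>\<close> is split: one half pays for
  this power, the other half remains for convergence.\<close>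

lemma integrable_terminal_value_log:
  fixes \<mu> p :: real
  assumes \<mu>: "0 < \<mu>" "\<mu> < 1" and p: "1 \<le> p"
  shows "integrable M (\<lambda>\<omega>. terminal_value W \<mu> \<omega> * ln (terminal_value W \<mu> \<omega> + 1) powr p)"
proof -
  define q where "q = (\<lambda>x. (\<bar>x\<bar> - \<mu>)\<^sup>2 / 2)"
  define K where "K = max 1 (2 * p / (\<mu> / 2)) powr (2 * p)"
  have "integrable M (\<lambda>\<omega>. (exp (q (W 1 \<omega>)) - 1) * q (W 1 \<omega>) powr p)"
  proof (rule integrable_terminal[where c = "\<mu> / 2" and K = "exp (1 / 2) * K"
        and g = "\<lambda>x. (exp (q x) - 1) * q x powr p"])
    fix x :: real
    have "q x \<le> (1 + \<bar>x\<bar>)\<^sup>2"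
    proof -
      have "(\<bar>x\<bar> - \<mu>)\<^sup>2 \<le> (1 + \<bar>x\<bar>)\<^sup>2"
        using \<mu> by (intro abs_le_square_iff[THEN iffD1]) auto
      then show ?thesis
        using zero_le_power2[of "\<bar>x\<bar> - \<mu>"] unfolding q_def by linarith
    qed
    then have "q x powr p \<le> ((1 + \<bar>x\<bar>)\<^sup>2) powr p"
      using p by (intro powr_mono2) (auto simp: q_def)
    also have "\<dots> = (1 + \<bar>x\<bar>) powr (2 * p)"
      by (simp add: powr_powr[symmetric] powr_numeral)
    also have "\<dots> \<le> K * exp (\<mu> / 2 * \<bar>x\<bar>)"
      unfolding K_def using p \<mu> by (intro powr_le_exp) auto
    finally have 1: "q x powr p \<le> K * exp (\<mu> / 2 * \<bar>x\<bar>)" .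
    have 2: "exp (q x) - 1 \<le> exp (1 / 2) * exp (x\<^sup>2 / 2 - \<mu> * \<bar>x\<bar>)"
      using exp_square_shift_le[of \<mu> x] \<mu> unfolding q_def by linarith
    have 3: "1 \<le> exp (q x)" by (simp add: q_def)
    have "\<bar>(exp (q x) - 1) * q x powr p\<bar> \<le>
        (exp (1 / 2) * exp (x\<^sup>2 / 2 - \<mu> * \<bar>x\<bar>)) * (K * exp (\<mu> / 2 * \<bar>x\<bar>))"
      using 1 2 3 by (auto simp: abs_mult intro!: mult_mono)
    also have "\<dots> = exp (1 / 2) * K * (exp (x\<^sup>2 / 2 - \<mu> * \<bar>x\<bar>) * exp (\<mu> / 2 * \<bar>x\<bar>))"
      by simp
    also have "exp (x\<^sup>2 / 2 - \<mu> * \<bar>x\<bar>) * exp (\<mu> / 2 * \<bar>x\<bar>) = exp (x\<^sup>2 / 2 - \<mu> / 2 * \<bar>x\<bar>)"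
      by (simp add: exp_add[symmetric])
    finally show "\<bar>(exp (q x) - 1) * q x powr p\<bar> \<le> exp (1 / 2) * K * exp (x\<^sup>2 / 2 - \<mu> / 2 * \<bar>x\<bar>)" .
  qed (use \<mu> in \<open>auto simp: q_def\<close>)
  then show ?thesis
    by (simp add: terminal_value_eq q_def)
qed

text \<open>The divergence criterion applies to the terminal value plus 1, times
  \<open>exp |W 1|\<close>: for \<open>x \<ge> 0\<close> its exponent is
  \<open>x ^ 2 / 2 + (1 - \<mu>) * x + \<mu> ^ 2 / 2\<close>. The extra summand
  \<open>exp |W 1|\<close> has finite mean and can be taken away.\<close>

lemma nn_integral_terminal_value_exp:
  fixes \<mu> :: real
  assumes \<mu>: "0 < \<mu>" "\<mu> < 1"
  shows "(\<integral>\<^sup>+\<omega>. ennreal (terminal_value W \<mu> \<omega> * exp \<bar>W 1 \<omega>\<bar>) \<partial>M) = \<infinity>"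
proof -
  define q where "q = (\<lambda>x. (\<bar>x\<bar> - \<mu>)\<^sup>2 / 2)"
  have "integrable M (\<lambda>\<omega>. exp \<bar>W 1 \<omega>\<bar>)"
  proof (rule integrable_terminal[where c = 1 and K = "exp 2" and g = "\<lambda>x. exp \<bar>x\<bar>"])
    fix x :: real
    have "2 * \<bar>x\<bar> \<le> 2 + x\<^sup>2 / 2"
      using zero_le_power2[of "\<bar>x\<bar> - 2"] by (simp add: power2_diff)
    then show "\<bar>exp \<bar>x\<bar>\<bar> \<le> exp 2 * exp (x\<^sup>2 / 2 - 1 * \<bar>x\<bar>)"
      by (simp add: exp_add[symmetric])
  qed auto
  then have fin: "(\<integral>\<^sup>+\<omega>. ennreal (exp \<bar>W 1 \<omega>\<bar>) \<partial>M) < \<infinity>"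
    by (simp add: integrable_iff_bounded)
  have "\<infinity> = (\<integral>\<^sup>+\<omega>. ennreal (exp (q (W 1 \<omega>)) * exp \<bar>W 1 \<omega>\<bar>) \<partial>M)"
  proof (rule nn_integral_terminal_eq_top[where g = "\<lambda>x. exp (q x) * exp \<bar>x\<bar>" and c = 1, symmetric])
    fix x :: real assume "0 \<le> x"
    then have "\<mu> * x \<le> x" using \<mu> by (simp add: mult_left_le_one_le)
    then have "\<mu> * x \<le> x + \<mu>\<^sup>2 / 2" using zero_le_power2[of \<mu>] by linarith
    then show "1 * exp (x\<^sup>2 / 2) \<le> exp (q x) * exp \<bar>x\<bar>"
      using \<open>0 \<le> x\<close> unfolding q_def exp_add[symmetric]
      by (simp add: power2_diff diff_divide_distrib add_divide_distrib algebra_simps)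
  qed (auto simp: q_def)
  also have "\<dots> = (\<integral>\<^sup>+\<omega>. ennreal ((exp (q (W 1 \<omega>)) - 1) * exp \<bar>W 1 \<omega>\<bar>) + ennreal (exp \<bar>W 1 \<omega>\<bar>) \<partial>M)"
    by (intro nn_integral_cong) (auto simp: q_def ennreal_plus[symmetric] algebra_simps simp del: ennreal_plus)
  also have "\<dots> = (\<integral>\<^sup>+\<omega>. ennreal ((exp (q (W 1 \<omega>)) - 1) * exp \<bar>W 1 \<omega>\<bar>) \<partial>M) + (\<integral>\<^sup>+\<omega>. ennreal (exp \<bar>W 1 \<omega>\<bar>) \<partial>M)"
    by (intro nn_integral_add) (auto simp: q_def)
  finally have "(\<integral>\<^sup>+\<omega>. ennreal ((exp (q (W 1 \<omega>)) - 1) * exp \<bar>W 1 \<omega>\<bar>) \<partial>M) = \<infinity> \<or>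
      (\<integral>\<^sup>+\<omega>. ennreal (exp \<bar>W 1 \<omega>\<bar>) \<partial>M) = \<infinity>"
    unfolding infinity_ennreal_def by (intro ennreal_add_eq_top[THEN iffD1]) (rule sym)
  then show ?thesis
    using fin by (auto simp: terminal_value_eq q_def)
qed

text \<open>At the terminal value the square root is
  \<open>||W 1| - \<mu>| / sqrt \<Lambda>\<close>, so it grows linearly in \<open>|W 1|\<close> with
  slope \<open>1 / sqrt \<Lambda>\<close>. It uses up that much of the rate \<open>\<mu>\<close>,
  and the hypothesis says that some rate is left.\<close>

lemma nn_integral_Psi_terminal_value:
  fixes \<mu> \<Lambda> :: real
  assumes \<Lambda>: "1 < \<Lambda>" and \<mu>: "1 / sqrt \<Lambda> < \<mu>" "\<mu> < 1"
  shows "(\<integral>\<^sup>+\<omega>. ennreal (Psi \<Lambda> (terminal_value W \<mu> \<omega>)) \<partial>M) < \<infinity>"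
proof -
  define q where "q = (\<lambda>x. (\<bar>x\<bar> - \<mu>)\<^sup>2 / 2)"
  have pos: "0 < 1 / sqrt \<Lambda>" using \<Lambda> by simp
  then have \<mu>0: "0 < \<mu>" using \<mu> by linarith
  have sqrt_eq: "sqrt (2 / \<Lambda> * q x) = \<bar>\<bar>x\<bar> - \<mu>\<bar> / sqrt \<Lambda>" for x
    by (simp add: q_def real_sqrt_divide)
  have "integrable M (\<lambda>\<omega>. (exp (q (W 1 \<omega>)) - 1) * exp (sqrt (2 / \<Lambda> * q (W 1 \<omega>))))"
  proof (rule integrable_terminal[where c = "\<mu> - 1 / sqrt \<Lambda>" and K = "exp (1 / 2) * exp (1 / sqrt \<Lambda>)"
        and g = "\<lambda>x. (exp (q x) - 1) * exp (sqrt (2 / \<Lambda> * q x))"])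
    fix x :: real
    have "\<bar>\<bar>x\<bar> - \<mu>\<bar> \<le> 1 + \<bar>x\<bar>"
      using \<mu> \<mu>0 by linarith
    then have "\<bar>\<bar>x\<bar> - \<mu>\<bar> * (1 / sqrt \<Lambda>) \<le> (1 + \<bar>x\<bar>) * (1 / sqrt \<Lambda>)"
      using pos by (intro mult_right_mono) auto
    then have 1: "exp (sqrt (2 / \<Lambda> * q x)) \<le> exp ((1 + \<bar>x\<bar>) * (1 / sqrt \<Lambda>))"
      unfolding sqrt_eq by simp
    have 2: "exp (q x) - 1 \<le> exp (1 / 2) * exp (x\<^sup>2 / 2 - \<mu> * \<bar>x\<bar>)"
      using exp_square_shift_le[of \<mu> x] \<mu> \<mu>0 unfolding q_def by linarith
    have 3: "1 \<le> exp (q x)" by (simp add: q_def)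
    have "\<bar>(exp (q x) - 1) * exp (sqrt (2 / \<Lambda> * q x))\<bar> \<le>
        (exp (1 / 2) * exp (x\<^sup>2 / 2 - \<mu> * \<bar>x\<bar>)) * exp ((1 + \<bar>x\<bar>) * (1 / sqrt \<Lambda>))"
      using 1 2 3 by (auto simp: abs_mult intro!: mult_mono)
    also have "\<dots> = exp (1 / 2) * exp (1 / sqrt \<Lambda>) * exp (x\<^sup>2 / 2 - (\<mu> - 1 / sqrt \<Lambda>) * \<bar>x\<bar>)"
      by (simp add: exp_add[symmetric] algebra_simps add_divide_distrib)
    finally show "\<bar>(exp (q x) - 1) * exp (sqrt (2 / \<Lambda> * q x))\<bar> \<le>
        exp (1 / 2) * exp (1 / sqrt \<Lambda>) * exp (x\<^sup>2 / 2 - (\<mu> - 1 / sqrt \<Lambda>) * \<bar>x\<bar>)" .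
  qed (use \<mu> in \<open>auto simp: q_def\<close>)
  then have "integrable M (\<lambda>\<omega>. Psi \<Lambda> (terminal_value W \<mu> \<omega>))"
    by (simp add: Psi_def terminal_value_eq q_def)
  moreover have "0 \<le> Psi \<Lambda> (terminal_value W \<mu> \<omega>)" for \<omega>
    by (simp add: Psi_def terminal_value_eq)
  ultimately show ?thesis
    by (simp add: integrable_iff_bounded)
qed

end

subsection \<open>Nonexistence of nonnegative solutions\<close>

text \<open>Only the slice at time 0 matters: rectangles over \<open>{s<..t}\<close> with
  \<open>0 \<le> s\<close> miss it, and those over \<open>{0}\<close> contribute events of
  \<open>F 0\<close>.\<close>

lemma predictable_initial_measurable:
  assumes Y: "predictable M F Y" and F: "\<And>t. space (F t) = space M"
  shows "Y 0 \<in> borel_measurable (F 0)"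
proof -
  let ?G = "{{0} \<times> A | A. A \<in> sets (F 0)} \<union>
    {{s<..t} \<times> A | s t A. 0 \<le> s \<and> s < t \<and> t \<le> 1 \<and> A \<in> sets (F s)}"
  have sub: "A \<subseteq> space M" if "A \<in> sets (F s)" for s A
    using sets.sets_into_space[OF that] F by simp
  have "(\<lambda>\<omega>. (0::real, \<omega>)) \<in> measurable (F 0) (predictable_algebra M F)"
    unfolding predictable_algebra_def
  proof (rule measurable_measure_of)
    show "?G \<subseteq> Pow ({0..1} \<times> space M)"
    proof
      fix X assume "X \<in> ?G"
      then consider A where "X = {0} \<times> A" "A \<in> sets (F 0)"
        | s t A where "X = {s<..t} \<times> A" "0 \<le> s" "t \<le> 1" "A \<in> sets (F s)"
        by blast
      then show "X \<in> Pow ({0..1} \<times> space M)"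
        by cases (use sub in fastforce)+
    qed
    fix X assume "X \<in> ?G"
    then consider A where "X = {0} \<times> A" "A \<in> sets (F 0)"
      | s t A where "X = {s<..t} \<times> A" "0 \<le> s"
      by blast
    then show "(\<lambda>\<omega>. (0, \<omega>)) -` X \<inter> space (F 0) \<in> sets (F 0)"
    proof cases
      case 1
      then have "(\<lambda>\<omega>. (0, \<omega>)) -` X \<inter> space (F 0) = A"
        using sub F by auto
      then show ?thesis using 1 by simp
    next
      case 2
      then have "(\<lambda>\<omega>. (0, \<omega>)) -` X \<inter> space (F 0) = {}"
        by auto
      then show ?thesis by simp
    qed
  qed (use F in auto)
  from measurable_compose[OF this Y[unfolded predictable_def]] show ?thesis
    by simp
qed

section \<open>Uniform bounds under the exponential weight, and the contradiction\<close>

context brownian_motion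
begin

text \<open>The point is that \<open>a + 2\<close> depends neither on the partition nor on the size
  of the weights, so it serves every approximant alike. \<open>X\<close> is nonnegative everywhere,
  so paths on which the integral falls below \<open>- a\<close> can simply be dropped.\<close>

lemma simple_integral_exp_bound:
  assumes si: "simple_integrand \<F> n \<tau> h" and a: "0 \<le> a" and B: "B \<in> sets (\<F> 0)"
  obtains X where "integrable M (\<lambda>\<omega>. exp (W 1 \<omega> - 1 / 2) * X \<omega>)"
    "expectation (\<lambda>\<omega>. exp (W 1 \<omega> - 1 / 2) * X \<omega>) \<le> a + 2"
    "\<And>\<omega>. 0 \<le> X \<omega>"
    "\<And>\<omega>. \<omega> \<in> B \<Longrightarrow> (\<And>t. t \<in> {0..1} \<Longrightarrow> simple_integral (\<lambda>t \<omega>. W t \<omega> - t) n \<tau> h t \<omega> > - a) \<Longrightarrow>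
      simple_integral (\<lambda>t \<omega>. W t \<omega> - t) n \<tau> h 1 \<omega> + a + 1 \<le> X \<omega>"
proof -
  have \<tau>: "\<tau> 0 = 0" "\<tau> n = 1" "\<And>i. i < n \<Longrightarrow> \<tau> i < \<tau> (Suc i)"
    and h: "\<And>i. i < n \<Longrightarrow> h i \<in> borel_measurable (\<F> (\<tau> i))"
      "\<And>i. i < n \<Longrightarrow> \<exists>C. \<forall>\<omega>\<in>space M. \<bar>h i \<omega>\<bar> \<le> C"
    using si by (auto simp: simple_integrand_def)
  obtain c where c: "\<And>i \<omega>. i < n \<Longrightarrow> \<omega> \<in> space M \<Longrightarrow> \<bar>h i \<omega>\<bar> \<le> c i"
    using h(2) by metis
  define C where "C = (\<Sum>i<n. \<bar>c i\<bar>)"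
  have C: "\<bar>h i \<omega>\<bar> \<le> C" if "i < n" "\<omega> \<in> space M" for i \<omega>
  proof -
    have "\<bar>c i\<bar> \<le> C"
      unfolding C_def using that by (intro member_le_sum) auto
    then show ?thesis using c[OF that] by linarith
  qed
  \<comment> \<open>Each grid step has length at most \<open>1 / m\<close> and the lengths add up to
    1, so the squared lengths add up to at most \<open>1 / m\<close> and the total overshoot is at
    most \<open>3 * C ^ 4 / m\<close>, hence below 1.\<close>
  obtain m :: nat where m: "3 * C ^ 4 < real m" "0 < m"
    using reals_Archimedean2[of "max 1 (3 * C ^ 4)"] by (metis less_nat_zero_code max_less_iff_conj not_gr0 of_nat_0 not_one_less_zero)
  define g where "g = refined_grid m \<tau>"
  define H where "H = (\<lambda>j. h (j div m))"
  define N where "N = n * m"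
  have idx: "j div m < n" if "j < N" for j
    using that m by (simp add: N_def div_less_iff_less_mult)
  have g: "g 0 = 0" "\<And>j. j < N \<Longrightarrow> g j < g (Suc j)" "g N = 1"
    using \<tau> m refined_grid_bounds(2)[OF m(2) \<tau>(3)[OF idx]]
    by (auto simp: g_def N_def refined_grid_def)
  have H: "H j \<in> borel_measurable (\<F> (g j))" if "j < N" for j
    unfolding H_def g_def
    by (rule measurable_augmented_filtration_mono[OF refined_grid_bounds(1)[OF m(2) \<tau>(3)[OF idx[OF that]]] h(1)[OF idx[OF that]]])
  have HC: "\<bar>H j \<omega>\<bar> \<le> C" if "j < N" "\<omega> \<in> space M" for j \<omega>
    unfolding H_def using C idx that by auto
  have g_mono: "g i \<le> g j" if "i \<le> j" "j \<le> N" for i j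
    using partition_mono[of N g i j] g(2) that by auto
  have g_unit: "g j \<in> {0..1}" if "j \<le> N" for j
    using g_mono[of 0 j] g_mono[of j N] that g by auto
  define D where "D = (\<lambda>\<omega> j. H j \<omega> * (W (g (Suc j)) \<omega> - W (g j) \<omega> - (g (Suc j) - g j)))"
  define X where "X = (\<lambda>\<omega>. absorbed_sum a (D \<omega>) N)"
  have "X \<in> borel_measurable (\<F> 1) \<and> integrable M (\<lambda>\<omega>. exp (W 1 \<omega> - 1 / 2)) \<and>
      expectation (\<lambda>\<omega>. exp (W 1 \<omega> - 1 / 2)) = 1 \<and>
      integrable M (\<lambda>\<omega>. exp (W 1 \<omega> - 1 / 2) * X \<omega>) \<and>
      expectation (\<lambda>\<omega>. exp (W 1 \<omega> - 1 / 2) * max (X \<omega>) (- a - 1) * indicator B \<omega>)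
        \<le> (\<Sum>j<N. 3 * C ^ 4 * (g (Suc j) - g j)\<^sup>2)"
    using discrete_supermartingale_bound[OF g H HC B a order_refl] g(3) by (simp add: X_def D_def)
  then have X: "X \<in> borel_measurable (\<F> 1)" "integrable M (\<lambda>\<omega>. exp (W 1 \<omega> - 1 / 2))"
    "expectation (\<lambda>\<omega>. exp (W 1 \<omega> - 1 / 2)) = 1" "integrable M (\<lambda>\<omega>. exp (W 1 \<omega> - 1 / 2) * X \<omega>)"
    "expectation (\<lambda>\<omega>. exp (W 1 \<omega> - 1 / 2) * max (X \<omega>) (- a - 1) * indicator B \<omega>)
        \<le> (\<Sum>j<N. 3 * C ^ 4 * (g (Suc j) - g j)\<^sup>2)"
    by auto
  have "(\<Sum>j<N. 3 * C ^ 4 * (g (Suc j) - g j)\<^sup>2) \<le> (\<Sum>j<N. 3 * C ^ 4 * (1 / real m) * (g (Suc j) - g j))"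
  proof (rule sum_mono)
    fix j assume "j \<in> {..<N}"
    then have j: "j div m < n" "j < N" using idx by auto
    have "\<tau> (Suc (j div m)) \<le> 1" "0 \<le> \<tau> (j div m)"
      using partition_mono[of n \<tau> "Suc (j div m)" n] partition_mono[of n \<tau> 0 "j div m"] \<tau> j by auto
    then have "g (Suc j) - g j \<le> 1 / real m"
      unfolding g_def refined_grid_step[OF m(2)] by (intro divide_right_mono) auto
    then have "(g (Suc j) - g j) * (g (Suc j) - g j) \<le> (1 / real m) * (g (Suc j) - g j)"
      using g(2)[OF j(2)] by (intro mult_right_mono) auto
    then have "3 * C ^ 4 * ((g (Suc j) - g j) * (g (Suc j) - g j)) \<le> 3 * C ^ 4 * ((1 / real m) * (g (Suc j) - g j))"
      by (rule mult_left_mono) simp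
    then show "3 * C ^ 4 * (g (Suc j) - g j)\<^sup>2 \<le> 3 * C ^ 4 * (1 / real m) * (g (Suc j) - g j)"
      by (simp add: power2_eq_square)
  qed
  also have "\<dots> = 3 * C ^ 4 * (1 / real m) * (g N - g 0)"
    unfolding sum_distrib_left[symmetric] by (simp add: sum_lessThan_telescope)
  also have "\<dots> \<le> 1"
    using m g by simp
  finally have X5: "expectation (\<lambda>\<omega>. exp (W 1 \<omega> - 1 / 2) * max (X \<omega>) (- a - 1) * indicator B \<omega>) \<le> 1"
    using X(5) by linarith
  have [measurable]: "X \<in> borel_measurable M" "B \<in> events"
    using measurable_events[OF _ X(1)] B sets_augmented_filtration_subset[of 0] by auto
  \<comment> \<open>The shift by \<open>a + 1\<close> makes the truncated sum nonnegative. As the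
    weights have mean 1, it costs at most \<open>a + 1\<close>; the overshoot adds at most 1, which
    gives \<open>a + 2\<close>.\<close>
  define X' where "X' = (\<lambda>\<omega>. (max (X \<omega>) (- a - 1) + a + 1) * indicator B \<omega>)"
  have int: "integrable M (\<lambda>\<omega>. exp (W 1 \<omega> - 1 / 2) * max (X \<omega>) (- a - 1) * indicator B \<omega>)"
    using integrable_weighted_max[OF X(2) _ X(4), of B "a + 1"] a by simp
  have int_B: "integrable M (\<lambda>\<omega>. exp (W 1 \<omega> - 1 / 2) * indicator B \<omega>)"
    using X(2) by (rule integrable_real_mult_indicator[rotated]) measurable
  have eq: "exp (W 1 \<omega> - 1 / 2) * X' \<omega> = exp (W 1 \<omega> - 1 / 2) * max (X \<omega>) (- a - 1) * indicator B \<omega> +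
      (a + 1) * (exp (W 1 \<omega> - 1 / 2) * indicator B \<omega>)" for \<omega>
    by (simp add: X'_def algebra_simps)
  show ?thesis
  proof (rule that)
    show "integrable M (\<lambda>\<omega>. exp (W 1 \<omega> - 1 / 2) * X' \<omega>)"
      unfolding eq using int int_B by simp
    have "expectation (\<lambda>\<omega>. exp (W 1 \<omega> - 1 / 2) * indicator B \<omega>) \<le> expectation (\<lambda>\<omega>. exp (W 1 \<omega> - 1 / 2))"
      using X(2) int_B by (intro integral_mono) (auto simp: indicator_def)
    then have "(a + 1) * expectation (\<lambda>\<omega>. exp (W 1 \<omega> - 1 / 2) * indicator B \<omega>) \<le> (a + 1) * 1"
      using a X(3) by (intro mult_left_mono) auto
    then show "expectation (\<lambda>\<omega>. exp (W 1 \<omega> - 1 / 2) * X' \<omega>) \<le> a + 2"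
      unfolding eq using int int_B X5 by simp
    show "0 \<le> X' \<omega>" for \<omega>
      by (auto simp: X'_def indicator_def max_def)
    fix \<omega> assume "\<omega> \<in> B"
      and lower: "\<And>t. t \<in> {0..1} \<Longrightarrow> simple_integral (\<lambda>t \<omega>. W t \<omega> - t) n \<tau> h t \<omega> > - a"
    have grid: "simple_integral (\<lambda>t \<omega>. W t \<omega> - t) n \<tau> h (g l) \<omega> = (\<Sum>j<l. D \<omega> j)" if "l \<le> N" for l
      unfolding g_def
      using simple_integral_refined_grid[of \<tau> n m l "\<lambda>t \<omega>. W t \<omega> - t" h \<omega>] \<tau> m that
      by (auto simp: D_def H_def g_def N_def intro!: sum.cong)
    \<comment> \<open>The integral stays above \<open>- a\<close> along the path, in particular at
      the grid times, so nothing is ever frozen.\<close>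
    have "X \<omega> = (\<Sum>j<N. D \<omega> j)"
      unfolding X_def
    proof (rule absorbed_sum_eq_sum)
      fix l assume "l < N"
      then have "l \<le> N" by simp
      from lower[OF g_unit[OF this]] show "(\<Sum>j<l. D \<omega> j) > - a"
        unfolding grid[OF \<open>l \<le> N\<close>] .
    qed
    also have "\<dots> = simple_integral (\<lambda>t \<omega>. W t \<omega> - t) n \<tau> h 1 \<omega>"
      using grid[of N] g by simp
    finally show "simple_integral (\<lambda>t \<omega>. W t \<omega> - t) n \<tau> h 1 \<omega> + a + 1 \<le> X' \<omega>"
      using \<open>\<omega> \<in> B\<close> by (simp add: X'_def)
  qed
qed

text \<open>The bound is free of \<open>R\<close>. On \<open>B\<close> and off the bad event, the
  equation and \<open>Y \<ge> 0\<close> keep the approximant above \<open>- a\<close>, and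
  \<open>X\<close> dominates the terminal value plus 1; on the bad event the integrand is at most
  \<open>R\<close>, and \<open>k\<close> is chosen so that this contributes at most 1 to
  \<open>a + 3\<close>. The summand 5 in \<open>a\<close> is the pathwise loss 4 plus 1 to make the
  lower bound strict.\<close>

lemma exp_terminal_value_truncated_bound:
  assumes sol: "bsde_solution M W \<alpha> (terminal_value W \<mu>) Y Z" and nonneg: "nonneg_process M Y"
    and \<alpha>: "set_integrable lebesgue {0<..<1} \<alpha>"
    and B: "B \<in> sets (\<F> 0)" and C: "\<And>\<omega>. \<omega> \<in> B \<Longrightarrow> Y 0 \<omega> \<le> C" and R: "0 \<le> R"
  defines "a \<equiv> \<bar>C\<bar> + (LINT s:{0..1}|lebesgue. \<bar>\<alpha> s\<bar>) + 5"
  shows "expectation (\<lambda>\<omega>. indicator B \<omega> *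
    min (exp (W 1 \<omega> - 1 / 2) * (terminal_value W \<mu> \<omega> + 1)) R) \<le> a + 3"
proof -
  let ?\<xi> = "terminal_value W \<mu>"
  let ?E = "\<lambda>\<omega>. exp (W 1 \<omega> - 1 / 2)"
  have "0 \<le> (LINT s:{0..1}|lebesgue. \<bar>\<alpha> s\<bar>)"
    by (auto simp: set_lebesgue_integral_def)
  then have a: "0 \<le> a" unfolding a_def by linarith
  have [measurable]: "B \<in> events"
    using B sets_augmented_filtration_subset[of 0] by auto
  have \<xi>_meas [measurable]: "?\<xi> \<in> borel_measurable M"
    unfolding terminal_value_def by measurable
  obtain J where Z: "AE \<omega> in M. set_integrable lebesgue {0<..<1} (\<lambda>t. \<alpha> t + \<bar>Z t \<omega>\<bar>)"
    and J: "has_ito_integral M \<F> W Z J"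
    and eqn: "AE \<omega> in M. \<forall>t\<in>{0..1}. Y t \<omega> = ?\<xi> \<omega> +
      (LINT s:{t..1}|lebesgue. \<alpha> s + \<bar>Z s \<omega>\<bar>) - (J 1 \<omega> - J t \<omega>)"
    using sol by (auto simp: bsde_solution_def)
  obtain n \<tau> h where si: "\<And>k. simple_integrand \<F> (n k) (\<tau> k) (h k)"
    and P: "null_in_probability M (\<lambda>k \<omega>. \<integral>\<^sup>+s\<in>{0<..<1}.
        ennreal ((simple_process (n k) (\<tau> k) (h k) s \<omega> - Z s \<omega>)\<^sup>2) \<partial>lebesgue)"
    and S: "null_in_probability M (\<lambda>k \<omega>. SUP t\<in>{0..1}.
        ennreal \<bar>simple_integral W (n k) (\<tau> k) (h k) t \<omega> - J t \<omega>\<bar>)"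
    using J by (auto simp: has_ito_integral_def)
  define p where "p = (\<lambda>k \<omega>. \<integral>\<^sup>+s\<in>{0<..<1}.
        ennreal ((simple_process (n k) (\<tau> k) (h k) s \<omega> - Z s \<omega>)\<^sup>2) \<partial>lebesgue)"
  define s where "s = (\<lambda>k \<omega>. SUP t\<in>{0..1}.
        ennreal \<bar>simple_integral W (n k) (\<tau> k) (h k) t \<omega> - J t \<omega>\<bar>)"
  have [measurable]: "p k \<in> borel_measurable M" "s k \<in> borel_measurable M" for k
    using P S by (auto simp: null_in_probability_def p_def s_def)
  define Bad where "Bad = (\<lambda>k. {\<omega> \<in> space M. p k \<omega> > ennreal 1} \<union> {\<omega> \<in> space M. s k \<omega> > ennreal 1})"
  have Bad_meas [measurable]: "Bad k \<in> events" for k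
    unfolding Bad_def by measurable
  have lim: "(\<lambda>k. prob {\<omega> \<in> space M. p k \<omega> > ennreal 1} + prob {\<omega> \<in> space M. s k \<omega> > ennreal 1}) \<longlonglongrightarrow> 0 + 0"
  proof (rule tendsto_add)
    have "null_in_probability M p" "null_in_probability M s"
      using P S by (simp_all add: p_def s_def)
    then show "(\<lambda>k. prob {\<omega> \<in> space M. p k \<omega> > ennreal 1}) \<longlonglongrightarrow> 0"
      "(\<lambda>k. prob {\<omega> \<in> space M. s k \<omega> > ennreal 1}) \<longlonglongrightarrow> 0"
      unfolding null_in_probability_def using zero_less_one by blast+
  qed
  have "\<exists>k. R * prob (Bad k) \<le> 1"
  proof -
    have "(\<lambda>k. R * (prob {\<omega> \<in> space M. p k \<omega> > ennreal 1} + prob {\<omega> \<in> space M. s k \<omega> > ennreal 1})) \<longlonglongrightarrow> R * (0 + 0)"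
      using lim by (intro tendsto_mult tendsto_const)
    then have "eventually (\<lambda>k. R * (prob {\<omega> \<in> space M. p k \<omega> > ennreal 1} + prob {\<omega> \<in> space M. s k \<omega> > ennreal 1}) < 1) sequentially"
      by (rule order_tendstoD(2)) simp
    then obtain k where k: "R * (prob {\<omega> \<in> space M. p k \<omega> > ennreal 1} + prob {\<omega> \<in> space M. s k \<omega> > ennreal 1}) < 1"
      using eventually_happens'[OF sequentially_bot] by blast
    have "prob (Bad k) \<le> prob {\<omega> \<in> space M. p k \<omega> > ennreal 1} + prob {\<omega> \<in> space M. s k \<omega> > ennreal 1}"
      unfolding Bad_def by (rule measure_Un_le) measurable
    then have "R * prob (Bad k) \<le> R * (prob {\<omega> \<in> space M. p k \<omega> > ennreal 1} + prob {\<omega> \<in> space M. s k \<omega> > ennreal 1})"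
      using R by (rule mult_left_mono)
    with k show ?thesis by (intro exI[of _ k]) linarith
  qed
  then obtain k where k: "R * prob (Bad k) \<le> 1" by auto
  have \<tau>: "\<tau> k 0 = 0" "\<And>i. i < n k \<Longrightarrow> \<tau> k i < \<tau> k (Suc i)"
    using si[of k] by (auto simp: simple_integrand_def)
  obtain X where X: "integrable M (\<lambda>\<omega>. ?E \<omega> * X \<omega>)" "expectation (\<lambda>\<omega>. ?E \<omega> * X \<omega>) \<le> a + 2"
    "\<And>\<omega>. 0 \<le> X \<omega>"
    "\<And>\<omega>. \<omega> \<in> B \<Longrightarrow> (\<And>t. t \<in> {0..1} \<Longrightarrow> simple_integral (\<lambda>t \<omega>. W t \<omega> - t) (n k) (\<tau> k) (h k) t \<omega> > - a) \<Longrightarrow>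
      simple_integral (\<lambda>t \<omega>. W t \<omega> - t) (n k) (\<tau> k) (h k) 1 \<omega> + a + 1 \<le> X \<omega>"
    using simple_integral_exp_bound[OF si a B, of k] by blast
  have "AE \<omega> in M. indicator B \<omega> * min (?E \<omega> * (?\<xi> \<omega> + 1)) R \<le> ?E \<omega> * X \<omega> + R * indicator (Bad k) \<omega>"
    using Z eqn nonneg[unfolded nonneg_process_def] AE_space
  proof eventually_elim
    case (elim \<omega>)
    show ?case
    proof (cases "\<omega> \<in> B \<and> \<omega> \<notin> Bad k")
      case False
      have "0 \<le> ?E \<omega> * X \<omega>" using X(3) by simp
      then show ?thesis using False R by (auto simp: indicator_def)
    next
      case True
      then have close: "p k \<omega> \<le> 1" "s k \<omega> \<le> 1"
        using \<open>\<omega> \<in> space M\<close> by (auto simp: Bad_def not_less)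
      have j: "\<bar>simple_integral W (n k) (\<tau> k) (h k) t \<omega> - J t \<omega>\<bar> \<le> 1" if "t \<in> {0..1}" for t
      proof -
        have "ennreal \<bar>simple_integral W (n k) (\<tau> k) (h k) t \<omega> - J t \<omega>\<bar> \<le> s k \<omega>"
          unfolding s_def by (rule SUP_upper[OF that])
        also have "\<dots> \<le> ennreal 1" using close by simp
        finally show ?thesis by simp
      qed
      have low: "simple_integral (\<lambda>t \<omega>. W t \<omega> - t) (n k) (\<tau> k) (h k) t \<omega> \<ge> Y t \<omega> - a + 1" if "t \<in> {0..1}" for t
      proof -
        have "simple_integral (\<lambda>t \<omega>. W t \<omega> - t) (n k) (\<tau> k) (h k) t \<omega> \<ge>
            Y t \<omega> - Y 0 \<omega> - (LINT s:{0..1}|lebesgue. \<bar>\<alpha> s\<bar>) - 4"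
          by (rule simple_integral_lower_bound[where j = "\<lambda>t. J t \<omega>" and z = "\<lambda>t. Z t \<omega>" and \<xi> = "?\<xi> \<omega>"])
            (use \<tau> \<alpha> elim close j that in \<open>auto simp: p_def\<close>)
        then show ?thesis
          using C[of \<omega>] True abs_ge_self[of C] unfolding a_def by linarith
      qed
      have "simple_integral (\<lambda>t \<omega>. W t \<omega> - t) (n k) (\<tau> k) (h k) t \<omega> > - a" if "t \<in> {0..1}" for t
        using low[OF that] elim(3) that by fastforce
      then have "simple_integral (\<lambda>t \<omega>. W t \<omega> - t) (n k) (\<tau> k) (h k) 1 \<omega> + a + 1 \<le> X \<omega>"
        using True X(4) by blast
      \<comment> \<open>At time 1 the driver is integrated over a single point, so the equation
        returns the terminal condition.\<close>
      moreover have "Y 1 \<omega> = ?\<xi> \<omega>"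
      proof -
        have "(LINT s:{1..1}|lebesgue. \<alpha> s + \<bar>Z s \<omega>\<bar>) = 0"
          unfolding set_lebesgue_integral_def
          by (rule integral_eq_zero_AE) (rule AE_I[of _ _ "{1}"]; auto simp: indicator_def)
        then show ?thesis
          using elim(2)[rule_format, of 1] by simp
      qed
      ultimately have "?\<xi> \<omega> + 1 \<le> X \<omega>"
        using low[of 1] by simp
      then have "?E \<omega> * (?\<xi> \<omega> + 1) \<le> ?E \<omega> * X \<omega>"
        by (intro mult_left_mono) auto
      then show ?thesis
        using True by (simp add: min.coboundedI1)
    qed
  qed
  moreover have Bad_int: "integrable M (\<lambda>\<omega>. R * indicator (Bad k) \<omega>)"
    by (intro integrable_mult_right integrable_real_indicator) (auto simp: emeasure_eq_measure)
  ultimately have "expectation (\<lambda>\<omega>. indicator B \<omega> * min (?E \<omega> * (?\<xi> \<omega> + 1)) R)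
      \<le> expectation (\<lambda>\<omega>. ?E \<omega> * X \<omega> + R * indicator (Bad k) \<omega>)"
  proof (intro integral_mono_AE)
    show "integrable M (\<lambda>\<omega>. indicator B \<omega> * min (?E \<omega> * (?\<xi> \<omega> + 1)) R)"
    proof (rule integrable_const_bound[of _ R])
      show "AE \<omega> in M. norm (indicator B \<omega> * min (?E \<omega> * (?\<xi> \<omega> + 1)) R) \<le> R"
        using R by (intro AE_I2) (auto simp: indicator_def terminal_value_eq)
    qed measurable
  qed (use X(1) in auto)
  also have "\<dots> = expectation (\<lambda>\<omega>. ?E \<omega> * X \<omega>) + R * prob (Bad k)"
    using X(1) Bad_int by simp
  finally show ?thesis
    using X(2) k by linarith
qed

lemma no_nonneg_solution:
  fixes \<mu> :: real
  assumes \<mu>: "0 < \<mu>" "\<mu> < 1" and \<alpha>: "set_integrable lebesgue {0<..<1} \<alpha>"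
    and sol: "bsde_solution M W \<alpha> (terminal_value W \<mu>) Y Z" and nonneg: "nonneg_process M Y"
  shows False
proof -
  have Y0 [measurable]: "Y 0 \<in> borel_measurable (\<F> 0)"
    using sol by (intro predictable_initial_measurable) (auto simp: bsde_solution_def)
  define B where "B = (\<lambda>C::nat. {\<omega> \<in> space (\<F> 0). Y 0 \<omega> \<le> real C})"
  have B: "B C \<in> sets (\<F> 0)" for C
    unfolding B_def by measurable
  have Bev: "B C \<in> events" for C
    using B sets_augmented_filtration_subset[of 0] by auto
  have "\<exists>C. 0 < prob (B C)"
  proof (rule ccontr)
    assume "\<not> ?thesis"
    then have "prob (B C) = 0" for C
      by (metis measure_nonneg less_eq_real_def)
    then have "B C \<in> null_sets M" for C
      using Bev by (auto simp: emeasure_eq_measure null_sets_def)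
    then have "(\<Union>C. B C) \<in> null_sets M" by blast
    moreover have "(\<Union>C. B C) = space M"
      using real_arch_simple by (auto simp: B_def)
    ultimately show False
      using emeasure_space_1 by (auto simp: null_sets_def)
  qed
  then obtain C where C: "0 < prob (B C)" by auto
  define f where "f = (\<lambda>x. exp (x - 1 / 2) * exp ((\<bar>x\<bar> - \<mu>)\<^sup>2 / 2))"
  have f_meas [measurable]: "f \<in> borel_measurable borel"
    unfolding f_def by measurable
  \<comment> \<open>The numerator is the truncated bound \<open>a + 3\<close> with \<open>a\<close>
    written out; dividing by \<open>prob (B C)\<close> undoes the restriction to
    \<open>B C\<close>.\<close>
  define K where "K = (\<bar>real C\<bar> + (LINT s:{0..1}|lebesgue. \<bar>\<alpha> s\<bar>) + 5 + 3) / prob (B C)"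
  have [measurable]: "W 0 \<in> borel_measurable M"
    by (rule random_variable_W) simp
  have f_nonneg: "0 \<le> f x" for x by (simp add: f_def)
  have bound: "expectation (\<lambda>\<omega>. min (f (W 1 \<omega>)) (real R)) \<le> K" for R :: nat
  proof -
    \<comment> \<open>Independence from \<open>B C\<close> is available for the increment
      \<open>W 1 - W 0\<close>, which equals \<open>W 1\<close> only almost surely; hence the
      passage to the increment and back.\<close>
    have int: "integrable M (\<lambda>\<omega>. min (f (W 1 \<omega> - W 0 \<omega>)) (real R))"
      by (rule integrable_const_bound[of _ "real R"]) (auto simp: f_nonneg)
    have ind: "integrable M (indicator (B C) :: 'a \<Rightarrow> real)"
        "(indicator (B C) :: 'a \<Rightarrow> real) \<in> borel_measurable (\<F> 0)"
      using Bev[of C] by (auto simp: emeasure_eq_measure intro!: borel_measurable_indicator[OF B])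
    have "expectation (\<lambda>\<omega>. min (f (W 1 \<omega>)) (real R)) = expectation (\<lambda>\<omega>. min (f (W 1 \<omega> - W 0 \<omega>)) (real R))"
      by (rule integral_cong_AE) (use AE_increment_W1 in auto)
    moreover have "prob (B C) * expectation (\<lambda>\<omega>. min (f (W 1 \<omega> - W 0 \<omega>)) (real R)) =
        expectation (\<lambda>\<omega>. indicator (B C) \<omega> * min (f (W 1 \<omega> - W 0 \<omega>)) (real R))"
      using expectation_increment_mult[of 0 1 "indicator (B C)" "\<lambda>x. min (f x) (real R)"] ind int Bev by simp
    moreover have "\<dots> = expectation (\<lambda>\<omega>. indicator (B C) \<omega> *
        min (exp (W 1 \<omega> - 1 / 2) * (terminal_value W \<mu> \<omega> + 1)) (real R))"
    proof (rule integral_cong_AE)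
      show "AE \<omega> in M. indicator (B C) \<omega> * min (f (W 1 \<omega> - W 0 \<omega>)) (real R) =
          indicator (B C) \<omega> * min (exp (W 1 \<omega> - 1 / 2) * (terminal_value W \<mu> \<omega> + 1)) (real R)"
        using AE_increment_W1 by eventually_elim (simp only: f_def terminal_value_eq diff_add_cancel)
    qed (use Bev[of C] in \<open>auto simp: terminal_value_def\<close>)
    moreover have "\<dots> \<le> \<bar>real C\<bar> + (LINT s:{0..1}|lebesgue. \<bar>\<alpha> s\<bar>) + 5 + 3"
      by (rule exp_terminal_value_truncated_bound[OF sol nonneg \<alpha> B]) (auto simp: B_def)
    ultimately show ?thesis
      using C by (simp add: K_def pos_le_divide_eq mult.commute)
  qed
  have "(\<integral>\<^sup>+\<omega>. ennreal (f (W 1 \<omega>)) \<partial>M) = (\<integral>\<^sup>+\<omega>. (SUP R. ennreal (min (f (W 1 \<omega>)) (real R))) \<partial>M)"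
  proof (rule nn_integral_cong)
    fix \<omega>
    obtain R where "f (W 1 \<omega>) \<le> real R" using real_arch_simple by blast
    then have "ennreal (f (W 1 \<omega>)) \<le> (SUP R. ennreal (min (f (W 1 \<omega>)) (real R)))"
      by (intro SUP_upper2[of R]) auto
    then show "ennreal (f (W 1 \<omega>)) = (SUP R. ennreal (min (f (W 1 \<omega>)) (real R)))"
      by (intro antisym SUP_least) (auto intro: ennreal_leI)
  qed
  also have "\<dots> = (SUP R. \<integral>\<^sup>+\<omega>. ennreal (min (f (W 1 \<omega>)) (real R)) \<partial>M)"
    by (rule nn_integral_monotone_convergence_SUP)
      (auto simp: incseq_def le_fun_def intro!: ennreal_leI min.mono)
  also have "\<dots> \<le> ennreal K"
  proof (rule SUP_least)
    fix R :: nat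
    have "(\<integral>\<^sup>+\<omega>. ennreal (min (f (W 1 \<omega>)) (real R)) \<partial>M) = ennreal (expectation (\<lambda>\<omega>. min (f (W 1 \<omega>)) (real R)))"
      by (intro nn_integral_eq_integral integrable_const_bound[of _ "real R"]) (auto simp: f_nonneg)
    then show "(\<integral>\<^sup>+\<omega>. ennreal (min (f (W 1 \<omega>)) (real R)) \<partial>M) \<le> ennreal K"
      using bound[of R] by (simp add: ennreal_leI)
  qed
  finally have "(\<integral>\<^sup>+\<omega>. ennreal (f (W 1 \<omega>)) \<partial>M) \<le> ennreal K" .
  moreover have "(\<integral>\<^sup>+\<omega>. ennreal (f (W 1 \<omega>)) \<partial>M) = \<infinity>"
  \<comment> \<open>The constant is the normalisation of the weight at time 1; for
    \<open>x \<ge> 0\<close> the rest of the exponent beyond \<open>x ^ 2 / 2\<close> is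
    \<open>(1 - \<mu>) * x + \<mu> ^ 2 / 2\<close>, which is nonnegative.\<close>
  proof (rule nn_integral_terminal_eq_top[where c = "exp (- 1 / 2)"])
    fix x :: real assume "0 \<le> x"
    then have "\<mu> * x \<le> x" using \<mu> by (simp add: mult_left_le_one_le)
    then have "\<mu> * x \<le> x + \<mu>\<^sup>2 / 2" using zero_le_power2[of \<mu>] by linarith
    then show "exp (- 1 / 2) * exp (x\<^sup>2 / 2) \<le> f x"
      using \<open>0 \<le> x\<close> unfolding f_def exp_add[symmetric]
      by (simp add: power2_diff diff_divide_distrib add_divide_distrib algebra_simps)
  qed auto
  ultimately show False by (simp add: top_unique)
qed

end

theorem mainTheorem2:
  fixes M :: "'a measure" and W :: "real \<Rightarrow> 'a \<Rightarrow> real" and \<alpha> :: "real \<Rightarrow> real"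
  assumes "brownian_motion M W"
    and "complete_measure M"
    and "set_integrable lebesgue {0<..<1} \<alpha>"
  shows
    "(\<forall>\<mu>\<in>{0<..<1::real}.
        (\<forall>p\<ge>1::real. integrable M
          (\<lambda>\<omega>. terminal_value W \<mu> \<omega> * ln (terminal_value W \<mu> \<omega> + 1) powr p)) \<and>
        (\<integral>\<^sup>+\<omega>. ennreal (terminal_value W \<mu> \<omega> * exp \<bar>W 1 \<omega>\<bar>) \<partial>M) = \<infinity> \<and>
        \<not> (\<exists>Y Z. bsde_solution M W \<alpha> (terminal_value W \<mu>) Y Z \<and> nonneg_process M Y)) \<and>
     (\<forall>\<Lambda>>1::real. \<forall>\<mu>\<in>{1 / sqrt \<Lambda><..<1}.
        (\<integral>\<^sup>+\<omega>. ennreal (Psi \<Lambda> (terminal_value W \<mu> \<omega>)) \<partial>M) < \<infinity> \<and>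
        \<not> (\<exists>Y Z. bsde_solution M W \<alpha> (terminal_value W \<mu>) Y Z \<and> nonneg_process M Y))"
proof -
  interpret brownian_motion M W by fact
  have no: "\<not> (\<exists>Y Z. bsde_solution M W \<alpha> (terminal_value W \<mu>) Y Z \<and> nonneg_process M Y)"
    if "0 < \<mu>" "\<mu> < 1" for \<mu>
    using no_nonneg_solution[OF that assms(3)] by blast
  \<comment> \<open>Positivity of \<open>\<mu>\<close> is implicit in the second claim, so the same
    nonexistence result serves both.\<close>
  have pos: "0 < \<mu>" if "1 < \<Lambda>" "1 / sqrt \<Lambda> < \<mu>" for \<Lambda> \<mu> :: real
    using that by (auto intro: less_trans[of 0 "1 / sqrt \<Lambda>"])
  show ?thesis
    using no pos integrable_terminal_value_log nn_integral_terminal_value_exp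
      nn_integral_Psi_terminal_value
    by auto
qed

end
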